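(* There is an absolute constant $c>0$ such that the following holds. Let $X$ be large and let $\delta>0$. Suppose that for each odd prime $p \leq X^{1/2}$ one has a set $S_p \subset \mathbb{Z}/p\mathbb{Z}$ of size $(p+1)/2$, and that for each such $p$ the set $S_p$ has at least $(\frac{1}{16}+\delta)p^3$ additive quadruples, that is quadruples $(s_1,s_2,s_3,s_4)\in S_p^4$ with $s_1+s_2=s_3+s_4$ in $\mathbb{Z}/p\mathbb{Z}$. Suppose that $\mathscr{A}$ is a set of positive integers with $\mathscr{A} \bmod p \subset S_p$ for all these primes $p$. Then $|\mathscr{A}[X]| \ll X^{1/2 - c\delta^2}$.
   Context: For a set $\mathscr{A}$ of positive integers, $\mathscr{A}[X] := \mathscr{A} \cap \{1,\dots,X\}$. $\mathscr{A} \bmod p$ denotes the set of residue classes modulo $p$ of elements of $\mathscr{A}$. *)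

theory Defs
  imports Complex_Main "HOL-Number_Theory.Residues"
begin

text \<open>
  The ring \<open>\<int>/p\<int>\<close> is \<^const>\<open>residue_ring\<close>, whose carrier is the set of
  least nonnegative residues \<open>{0..p - 1}\<close>.
\<close>

definition residue_classes_mod :: "nat set \<Rightarrow> nat \<Rightarrow> int set" where
  "residue_classes_mod A p = (\<lambda>a. int a mod int p) ` A"

definition additive_quadruples :: "nat \<Rightarrow> int set \<Rightarrow> (int \<times> int \<times> int \<times> int) set" where
  "additive_quadruples p S =
     {(s1, s2, s3, s4). s1 \<in> S \<and> s2 \<in> S \<and> s3 \<in> S \<and> s4 \<in> S \<and>
        s1 \<oplus>\<^bsub>residue_ring (int p)\<^esub> s2 = s3 \<oplus>\<^bsub>residue_ring (int p)\<^esub> s4}"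

definition truncation :: "nat set \<Rightarrow> nat \<Rightarrow> nat set" where
  "truncation A X = A \<inter> {1..X}"

definition sieving_primes :: "nat \<Rightarrow> nat set" where
  "sieving_primes X = {p. prime p \<and> odd p \<and> real p \<le> real X powr (1 / 2)}"

end

theory Submission
  imports Defs "HOL-Analysis.Analysis" "HOL-Real_Asymp.Real_Asymp"
begin

text \<open>
  Suppose that \<open>n = |A[X]|\<close> exceeds \<open>X powr (1/2 - \<kappa>)\<close> with \<open>\<kappa> = c\<delta>\<^sup>2\<close>. Near-equality in Gallagher's larger sieve
  makes \<open>A[X]\<close> almost equidistributed on \<open>S\<^sub>p\<close> for most \<open>p \<le> \<surd>X\<close>. The excess of additive quadruples gives
  a nontrivial frequency \<open>r\<^sub>p/p\<close> at which \<open>S\<^sub>p\<close>, and hence \<open>A[X]\<close>, has a Fourier coefficient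
  \<open>\<ge> \<surd>(\<delta>/2) n\<close>. There are about \<open>\<surd>X\<close> such frequencies, so a dual large sieve applied to
  \<open>\<Sum>\<^sub>p e(d r\<^sub>p/p)\<close> over differences \<open>d = a - a'\<close> shows that at least \<open>X powr (1/2 - \<epsilon>)\<close> differences \<open>d\<close> have at
  least \<open>X powr (1/2 - \<epsilon>)\<close> representations. For such \<open>d\<close>, the larger sieve for \<open>A \<inter> (A + d)\<close> forces
  \<open>S\<^sub>p \<inter> (S\<^sub>p + d)\<close> to be almost all of \<open>S\<^sub>p\<close> for most \<open>p\<close>. But a set of half the residues has at most
  about \<open>3p/8\<close> almost periods, so the larger sieve bounds the number of such \<open>d\<close> by a power of \<open>X\<close>
  with exponent less than \<open>1/2\<close>, a contradiction.
\<close>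

section \<open>Chebyshev and Mertens bounds for primes\<close>

text \<open>The larger sieve with (p+1)/2 classes modulo each p <= Q weighs 2 ln Q against ln X, so
  Q <= sqrt X sits exactly on the borderline and alone yields only O(sqrt X). It is therefore read
  as a stability statement: for a set of n > X^(1/2-k) elements the primes can be cut at some Q <= n
  not much below X^(1/2-k), the diagonal term 2Qn is then at most 2n^2, and the total loss is O(k ln
  X) n^2. Only the popular differences fall strictly below half of the classes: at most 3/4 |S_p|
  almost periods turn ln X into about 4/3 ln X on one side, and this gap pays for every earlier
  loss. The frequencies r_p for different p are unrelated; nothing but their spacing modulo 1 is
  used. Constants: 17/18 is chosen so that differences of almost periods still keep 8/9 of S_p;
  1/500 is what the gap 4/3 can afford; 1/100000 is small both against 1/500 and against the thin
  range from X^(499/1000) to X^(1/2) that supplies the good primes.\<close>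

lemma ln_prod_primes_le:
  fixes m :: nat and P :: "nat set"
  assumes "finite P" "\<And>p. p \<in> P \<Longrightarrow> prime p" "\<And>p. p \<in> P \<Longrightarrow> p dvd m" "m > 0"
  shows "(\<Sum>p\<in>P. ln (real p)) \<le> ln (real m)"
proof -
  have "(\<Prod>p\<in>P. p) dvd m"
    using assms(1-3)
  proof (induction P rule: finite_induct)
    case (insert q P)
    have "coprime q (\<Prod>p\<in>P. p)"
      using insert by (intro prod_coprime_right) (metis insertCI primes_coprime)
    then show ?case using insert by (simp add: divides_mult)
  qed simp
  then have "(\<Prod>p\<in>P. p) \<le> m" using assms(4) by (simp add: dvd_imp_le)
  then have le: "(\<Prod>p\<in>P. real p) \<le> real m" by (simp only: of_nat_prod[symmetric] of_nat_le_iff)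
  have pos: "\<And>p. p \<in> P \<Longrightarrow> real p > 0" using assms(2) prime_gt_0_nat by auto
  have "(\<Sum>p\<in>P. ln (real p)) = ln (\<Prod>p\<in>P. real p)"
    using pos assms(1) by (subst ln_prod) auto
  also have "\<dots> \<le> ln (real m)"
    using le pos assms(4) by (subst ln_le_cancel_iff) (auto intro: prod_pos)
  finally show ?thesis .
qed

lemma finite_primes_le [simp]: "finite {p::nat. prime p \<and> p \<le> n}"
  by (rule finite_subset[of _ "{..n}"]) auto

text \<open>Erdos's argument: for n = 2m+1 the primes in (m+1, n] all divide
  \<open>n choose m\<close>, which is at most 4^m, and the primes up to m+1 are left to the
  induction. The induction needs the constant ln 4; the 2 is a rounding at the end.\<close>

lemma chebyshev_theta_le: "(\<Sum>p | prime p \<and> p \<le> n. ln (real p)) \<le> 2 * real n" for n :: nat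
proof -
  have ln4: "ln (4::real) = 2 * ln 2" using ln_realpow[of 2 2] by simp
  have "(\<Sum>p | prime p \<and> p \<le> n. ln (real p)) \<le> ln 4 * real n"
  proof (induction n rule: less_induct)
    case (less n)
    consider "n \<le> 2" | "n > 2" "even n" | m where "n = 2 * m + 1" "m \<ge> 1"
      by (cases "n \<le> 2"; cases "even n") (auto elim!: oddE)
    then show ?case
    proof cases
      case 1
      have "{p::nat. prime p \<and> p \<le> n} = (if n = 2 then {2} else {})"
        using 1 by (auto dest: prime_ge_2_nat)
      then show ?thesis by (auto simp: ln4)
    next
      case 2
      then have "\<not> prime n" using prime_odd_nat by auto
      then have "p \<le> n \<longleftrightarrow> p \<le> n - 1" if "prime p" for p
        using that by (cases "p = n") auto
      then have "{p::nat. prime p \<and> p \<le> n} = {p. prime p \<and> p \<le> n - 1}" by blast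
      then have "(\<Sum>p | prime p \<and> p \<le> n. ln (real p)) \<le> ln 4 * real (n - 1)"
        using less.IH[of "n - 1"] 2 by simp
      also have "\<dots> \<le> ln 4 * real n" by (intro mult_left_mono) auto
      finally show ?thesis .
    next
      case (3 m)
      let ?P = "{p::nat. prime p \<and> m + 1 < p \<and> p \<le> n}"
      have fin: "finite ?P" by (rule finite_subset[of _ "{..n}"]) auto
      have dvd: "p dvd (n choose m)" if "p \<in> ?P" for p
      proof -
        have p: "prime p" "m + 1 < p" "p \<le> n" using that by auto
        have "fact m * fact (n - m) * (n choose m) = (fact n :: nat)"
          using 3 by (intro binomial_fact_lemma) auto
        moreover have "p dvd fact n" using p by (simp add: prime_dvd_fact_iff)
        moreover have "\<not> p dvd fact m" "\<not> p dvd fact (n - m)"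
          using p 3 by (auto simp: prime_dvd_fact_iff simp del: fact_Suc)
        ultimately show ?thesis by (metis p(1) prime_dvd_mult_iff)
      qed
      have "(\<Sum>p\<in>?P. ln (real p)) \<le> ln (real (n choose m))"
        using fin dvd 3 by (intro ln_prod_primes_le) auto
      also have "\<dots> \<le> ln (real (4 ^ m))"
      proof -
        \<comment> \<open>The two middle coefficients of an odd row agree, so each is at most half
          of 2^n.\<close>
        have "2 * (n choose m) = (n choose m) + (n choose (m + 1))"
          using 3 binomial_symmetric[of m n] by simp
        also have "\<dots> = (\<Sum>k\<in>{m, m + 1}. n choose k)" by simp
        also have "\<dots> \<le> (\<Sum>k\<le>n. n choose k)" using 3 by (intro sum_mono2) auto
        also have "\<dots> = 2 * 4 ^ m" unfolding choose_row_sum using 3 by (simp add: power_mult)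
        finally have "n choose m \<le> 4 ^ m" by simp
        then have "real (n choose m) \<le> real (4 ^ m)" by (simp only: of_nat_le_iff)
        moreover have "0 < real (n choose m)" using 3 by (simp add: zero_less_binomial_iff)
        ultimately show ?thesis by (intro ln_mono)
      qed
      also have "\<dots> = ln 4 * real m" by (simp add: ln_realpow)
      finally have A: "(\<Sum>p\<in>?P. ln (real p)) \<le> ln 4 * real m" .
      have "{p::nat. prime p \<and> p \<le> n} = {p. prime p \<and> p \<le> m + 1} \<union> ?P"
        using 3 by auto
      then have "(\<Sum>p | prime p \<and> p \<le> n. ln (real p)) =
          (\<Sum>p | prime p \<and> p \<le> m + 1. ln (real p)) + (\<Sum>p\<in>?P. ln (real p))"
        by (simp only:) (rule sum.union_disjoint, use fin in auto)
      also have "\<dots> \<le> ln 4 * real (m + 1) + ln 4 * real m"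
        using A less.IH[of "m + 1"] 3 by (intro add_mono) auto
      finally show ?thesis using 3 by (simp add: algebra_simps)
    qed
  qed
  moreover have "ln (4::real) \<le> 2"
    using ln4 ln_2_less_1 by simp
  then have "ln 4 * real n \<le> 2 * real n" by (intro mult_right_mono) auto
  ultimately show ?thesis by linarith
qed

section \<open>Exponents of primes in n! and Mertens' estimates\<close>

lemma multiplicity_eq_card:
  fixes p m n :: nat
  assumes "prime p" "1 \<le> m" "m \<le> n"
  shows "multiplicity p m = card {k\<in>{1..n}. p ^ k dvd m}"
proof -
  have iff: "p ^ k dvd m \<longleftrightarrow> k \<le> multiplicity p m" for k
    using assms by (intro power_dvd_iff_le_multiplicity) (auto simp: prime_gt_1_nat)
  have "multiplicity p m < p ^ multiplicity p m"
    using assms(1) prime_gt_1_nat by (intro power_gt_expt) auto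
  also have "\<dots> \<le> m" using assms by (intro dvd_imp_le multiplicity_dvd) auto
  finally have "{k\<in>{1..n}. p ^ k dvd m} = {1..multiplicity p m}" using assms by (auto simp: iff)
  then show ?thesis by simp
qed

text \<open>Swapping the sums counts, for each k, the multiples of p^k up to n. This is Legendre's
  formula for the exponent of p in n!.\<close>

lemma sum_multiplicity_eq:
  fixes p n :: nat
  assumes "prime p"
  shows "(\<Sum>m=1..n. multiplicity p m) = (\<Sum>k=1..n. n div p ^ k)"
proof -
  have "(\<Sum>m=1..n. multiplicity p m) = (\<Sum>m=1..n. \<Sum>k=1..n. if p ^ k dvd m then 1 else 0)"
    using assms by (intro sum.cong) (auto simp: multiplicity_eq_card sum.If_cases Int_def)
  also have "\<dots> = (\<Sum>k=1..n. \<Sum>m=1..n. if p ^ k dvd m then 1 else 0)" by (rule sum.swap)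
  also have "\<dots> = (\<Sum>k=1..n. n div p ^ k)"
  proof (intro sum.cong refl)
    fix k
    have pos: "p ^ k > 0" using assms prime_gt_0_nat by simp
    have "{m\<in>{1..n}. p ^ k dvd m} = (\<lambda>j. p ^ k * j) ` {1..n div p ^ k}"
      using pos by (auto simp: less_eq_div_iff_mult_less_eq mult.commute elim!: dvdE intro!: image_eqI)
    moreover have "inj_on (\<lambda>j. p ^ k * j) {1..n div p ^ k}" using pos by (auto simp: inj_on_def)
    ultimately have "card {m\<in>{1..n}. p ^ k dvd m} = n div p ^ k" by (simp add: card_image)
    then show "(\<Sum>m=1..n. if p ^ k dvd m then 1 else 0) = n div p ^ k"
      by (simp add: sum.If_cases Int_def)
  qed
  finally show ?thesis .
qed

lemma sum_ln_eq_sum_multiplicity: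
  "(\<Sum>m=1..n. ln (real m)) =
     (\<Sum>p | prime p \<and> p \<le> n. real (\<Sum>m=1..n. multiplicity p m) * ln (real p))"
proof -
  have "ln (real m) = (\<Sum>p | prime p \<and> p \<le> n. real (multiplicity p m) * ln (real p))"
    if m: "m \<in> {1..n}" for m
  proof -
    have "real m = real (\<Prod>p\<in>prime_factors m. p ^ multiplicity p m)"
      using m by (subst prime_factorization_nat[symmetric]) auto
    also have "\<dots> = (\<Prod>p\<in>prime_factors m. real p ^ multiplicity p m)" by simp
    finally have "ln (real m) = ln (\<Prod>p\<in>prime_factors m. real p ^ multiplicity p m)" by simp
    also have "\<dots> = (\<Sum>p\<in>prime_factors m. ln (real p ^ multiplicity p m))"
      by (intro ln_prod) (auto dest!: prime_factors_gt_0_nat)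
    also have "\<dots> = (\<Sum>p\<in>prime_factors m. real (multiplicity p m) * ln (real p))"
      by (intro sum.cong refl) (auto simp: ln_realpow)
    also have "\<dots> = (\<Sum>p | prime p \<and> p \<le> n. real (multiplicity p m) * ln (real p))"
      using m by (intro sum.mono_neutral_left)
        (auto simp: prime_factors_dvd prime_multiplicity_gt_zero_iff not_dvd_imp_multiplicity_0
           intro: order_trans[OF dvd_imp_le])
    finally show ?thesis .
  qed
  then have "(\<Sum>m=1..n. ln (real m)) =
      (\<Sum>m=1..n. \<Sum>p | prime p \<and> p \<le> n. real (multiplicity p m) * ln (real p))"
    by simp
  also have "\<dots> = (\<Sum>p | prime p \<and> p \<le> n. \<Sum>m=1..n. real (multiplicity p m) * ln (real p))"
    by (rule sum.swap)
  also have "\<dots> = (\<Sum>p | prime p \<and> p \<le> n. real (\<Sum>m=1..n. multiplicity p m) * ln (real p))"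
    by (simp add: sum_distrib_right)
  finally show ?thesis .
qed

lemma sum_multiplicity_le:
  fixes p n :: nat
  assumes p: "prime p"
  shows "real (\<Sum>m=1..n. multiplicity p m) \<le> real n / (real p - 1)"
proof -
  have p2: "real p \<ge> 2" using p prime_ge_2_nat by (metis of_nat_le_iff of_nat_numeral)
  have "real (\<Sum>m=1..n. multiplicity p m) = (\<Sum>k=1..n. real (n div p ^ k))"
    using sum_multiplicity_eq[OF p] by simp
  also have "\<dots> \<le> (\<Sum>k=1..n. real n * (1 / real p) ^ k)"
    using of_nat_div_le_of_nat[where ?'a = real, of n "p ^ k" for k]
    by (intro sum_mono) (simp add: power_one_over)
  also have "\<dots> = real n * (\<Sum>k=1..n. (1 / real p) ^ k)" by (simp add: sum_distrib_left)
  also have "(\<Sum>k=1..n. (1 / real p) ^ k) \<le> 1 / (real p - 1)"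
  proof -
    have "(\<Sum>k=1..n. (1 / real p) ^ k) = (1 - (1 / real p) ^ n) / (real p - 1)"
    proof -
      define q where "q = 1 / real p"
      have "q * real p = 1" using p2 by (simp add: q_def)
      then have qp: "q * (real p * z) = z" for z by (metis mult.assoc mult_1)
      have "(\<Sum>k=1..n. q ^ k) * (real p - 1) = 1 - q ^ n"
        by (induction n) (simp_all add: algebra_simps qp)
      then show ?thesis using p2 by (simp add: q_def eq_divide_eq)
    qed
    also have "\<dots> \<le> 1 / (real p - 1)" using p2 by (intro divide_right_mono) auto
    finally show ?thesis .
  qed
  finally show ?thesis by (simp add: mult_left_mono)
qed

lemma sum_ln_div_le: "(\<Sum>m=2..n. ln (real m) / (real m * (real m - 1))) \<le> 2"
proof (cases "n \<ge> 2")
  case True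
  \<comment> \<open>The subtracted terms make the induction telescope: ln m/(m(m-1)) = ln m/(m-1) -
    ln m/m, replacing ln m by ln(m-1) in the first fraction costs at most 1/(m-1)^2, and this is at
    most 1/(m-2) - 1/(m-1).\<close>
  then have "(\<Sum>m=2..n. ln (real m) / (real m * (real m - 1)))
      \<le> 2 - 1 / (real n - 1) - ln (real n) / real n"
  proof (induction n rule: nat_induct_at_least)
    case base show ?case using ln_2_less_1 by simp
  next
    case (Suc n)
    let ?x = "real n" and ?y = "real n + 1"
    have x: "?x \<ge> 2" using Suc by simp
    have l: "ln ?y \<le> ln ?x + 1 / ?x"
    proof -
      have "ln (?y / ?x) \<le> ?y / ?x - 1" using x by (intro ln_le_minus_one) auto
      then show ?thesis using x by (simp add: ln_div field_simps)
    qed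
    have "ln ?y / (?y * ?x) = ln ?y / ?x - ln ?y / ?y" using x by (simp add: field_simps)
    also have "\<dots> \<le> (ln ?x + 1 / ?x) / ?x - ln ?y / ?y" using l x by (simp add: divide_right_mono)
    finally have A: "ln ?y / (?y * ?x) \<le> ln ?x / ?x + 1 / (?x * ?x) - ln ?y / ?y"
      by (simp add: add_divide_distrib)
    have "(\<Sum>m=2..Suc n. ln (real m) / (real m * (real m - 1))) =
        ln ?y / (?y * ?x) + (\<Sum>m=2..n. ln (real m) / (real m * (real m - 1)))"
      using Suc.hyps by (simp add: sum.nat_ivl_Suc' add.commute)
    moreover have "1 / (?x * ?x) \<le> 1 / (?x - 1) - 1 / ?x"
      using x by (simp add: field_simps)
    ultimately show ?case
      using Suc.IH A by (simp add: add.commute)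
  qed
  moreover have "1 / (real n - 1) \<ge> 0" "ln (real n) / real n \<ge> 0" using True by auto
  ultimately show ?thesis by linarith
qed simp

text \<open>Compare n ln n - n <= ln n! with Legendre's formula. Of the constant 3, the Stirling
  bound takes 1 and passing from 1/(p-1) to 1/p takes 2, by \<open>sum_ln_div_le\<close>.\<close>

lemma mertens_lower_all:
  assumes "n \<ge> 1"
  shows "ln (real n) - 3 \<le> (\<Sum>p | prime p \<and> p \<le> n. ln (real p) / real p)"
proof -
  have lnfact: "real n * ln (real n) - real n \<le> (\<Sum>m=1..n. ln (real m))"
    using assms
  proof (induction n rule: nat_induct_at_least)
    case (Suc n)
    have "ln ((real n + 1) / real n) \<le> (real n + 1) / real n - 1"
      using Suc.hyps by (intro ln_le_minus_one) auto
    then have "real n * ln (real n + 1) \<le> real n * (ln (real n) + 1 / real n)"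
      using Suc.hyps by (intro mult_left_mono) (auto simp: ln_div field_simps)
    also have "\<dots> = real n * ln (real n) + 1" using Suc.hyps by (simp add: field_simps)
    finally show ?case using Suc by (simp add: algebra_simps)
  qed simp
  have "(\<Sum>m=1..n. ln (real m)) \<le> (\<Sum>p | prime p \<and> p \<le> n. real n / (real p - 1) * ln (real p))"
    unfolding sum_ln_eq_sum_multiplicity
    by (intro sum_mono mult_right_mono sum_multiplicity_le) (auto simp: Suc_leI prime_gt_0_nat)
  also have "\<dots> = real n * (\<Sum>p | prime p \<and> p \<le> n. ln (real p) / real p + ln (real p) / (real p * (real p - 1)))"
    unfolding sum_distrib_left
  proof (intro sum.cong refl)
    fix p assume "p \<in> {p. prime p \<and> p \<le> n}"
    then have "real p > 1" using prime_gt_1_nat by auto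
    then show "real n / (real p - 1) * ln (real p) =
        real n * (ln (real p) / real p + ln (real p) / (real p * (real p - 1)))"
      by (simp add: field_simps)
  qed
  finally have "real n * (ln (real n) - 1) \<le> real n *
      (\<Sum>p | prime p \<and> p \<le> n. ln (real p) / real p + ln (real p) / (real p * (real p - 1)))"
    using lnfact by (simp add: algebra_simps)
  then have "ln (real n) - 1 \<le>
      (\<Sum>p | prime p \<and> p \<le> n. ln (real p) / real p + ln (real p) / (real p * (real p - 1)))"
    using assms by simp
  moreover have "(\<Sum>p | prime p \<and> p \<le> n. ln (real p) / (real p * (real p - 1))) \<le> 2"
    by (rule order_trans[OF sum_mono2 sum_ln_div_le[of n]]) (auto dest: prime_ge_2_nat)
  ultimately show ?thesis by (simp add: sum.distrib)
qed

text \<open>Keep only the k = 1 term of Legendre's formula. Replacing n/p by its floor costs ln p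
  for each prime, hence 2n in total by Chebyshev, which is the constant 2 after division by
  n.\<close>

lemma mertens_upper_all:
  assumes "n \<ge> 1"
  shows "(\<Sum>p | prime p \<and> p \<le> n. ln (real p) / real p) \<le> ln (real n) + 2"
proof -
  have "real n * (\<Sum>p | prime p \<and> p \<le> n. ln (real p) / real p) =
      (\<Sum>p | prime p \<and> p \<le> n. real n / real p * ln (real p))"
    by (simp add: sum_distrib_left)
  also have "\<dots> \<le> (\<Sum>p | prime p \<and> p \<le> n. (real (\<Sum>m=1..n. multiplicity p m) + 1) * ln (real p))"
  proof (intro sum_mono mult_right_mono)
    fix p assume "p \<in> {p. prime p \<and> p \<le> n}"
    then have p: "prime p" by auto
    have "n div p ^ 1 \<le> (\<Sum>k=1..n. n div p ^ k)"
      using assms by (intro member_le_sum) auto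
    then have "real (n div p) \<le> real (\<Sum>m=1..n. multiplicity p m)"
      unfolding sum_multiplicity_eq[OF p] of_nat_le_iff by simp
    moreover have "real n / real p \<le> real (n div p) + 1"
      using real_of_int_floor_add_one_ge[of "real n / real p"]
      unfolding floor_divide_of_nat_eq by simp
    ultimately show "real n / real p \<le> real (\<Sum>m=1..n. multiplicity p m) + 1" by linarith
    show "0 \<le> ln (real p)" using p prime_ge_1_nat by simp
  qed
  also have "\<dots> = (\<Sum>m=1..n. ln (real m)) + (\<Sum>p | prime p \<and> p \<le> n. ln (real p))"
    unfolding sum_ln_eq_sum_multiplicity by (simp add: algebra_simps sum.distrib)
  also have "\<dots> \<le> (\<Sum>m=1..n. ln (real n)) + 2 * real n"
    by (intro add_mono chebyshev_theta_le sum_mono) auto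
  also have "\<dots> = real n * (ln (real n) + 2)" by (simp add: algebra_simps)
  finally show ?thesis using assms by simp
qed

lemma ln_of_nat_div_nonneg: "ln (real n) / real n \<ge> 0"
  by (cases "n = 0") auto

text \<open>The size (p+1)/2 is an integer only for odd p. The cutoff is a free natural number
  because the sieve also runs with bounds below sqrt X; \<open>sieving_primes_eq\<close> makes the
  link.\<close>

definition odd_primes :: "nat \<Rightarrow> nat set" where
  "odd_primes n = {p. prime p \<and> odd p \<and> p \<le> n}"

lemma finite_odd_primes [simp]: "finite (odd_primes n)"
  by (rule finite_subset[of _ "{..n}"]) (auto simp: odd_primes_def)

lemma odd_primesD: "p \<in> odd_primes n \<Longrightarrow> prime p \<and> odd p \<and> 3 \<le> p \<and> p \<le> n"
  using prime_ge_2_nat[of p] by (cases "p = 2") (auto simp: odd_primes_def)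

lemma odd_primes_theta: "(\<Sum>p\<in>odd_primes n. ln (real p)) \<le> 2 * real n"
  by (rule order_trans[OF sum_mono2 chebyshev_theta_le[of n]])
    (auto simp: odd_primes_def dest: prime_ge_1_nat)

lemma odd_primes_mertens_upper:
  assumes "n \<ge> 1"
  shows "(\<Sum>p\<in>odd_primes n. ln (real p) / real p) \<le> ln (real n) + 2"
  by (rule order_trans[OF sum_mono2 mertens_upper_all[OF assms]])
    (auto simp: odd_primes_def dest: prime_ge_1_nat)

lemma odd_primes_mertens_lower:
  assumes "n \<ge> 1"
  shows "ln (real n) - 4 \<le> (\<Sum>p\<in>odd_primes n. ln (real p) / real p)"
proof -
  have "(\<Sum>p | prime p \<and> p \<le> n. ln (real p) / real p) \<le>
      (\<Sum>p\<in>insert 2 (odd_primes n). ln (real p) / real p)"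
    by (intro sum_mono2) (auto simp: odd_primes_def dest: prime_ge_1_nat primes_dvd_imp_eq[OF two_is_prime_nat])
  also have "\<dots> \<le> ln 2 / 2 + (\<Sum>p\<in>odd_primes n. ln (real p) / real p)"
    by (subst sum.insert) (auto simp: odd_primes_def)
  finally show ?thesis using mertens_lower_all[OF assms] ln_2_less_1 by linarith
qed

text \<open>The weight 2 ln p/(p+1) is ln p/|S_p|, the one that the larger sieve produces. The
  constant 12 is 2*4 from the Mertens bound plus 2*2 from replacing 1/p by 1/(p+1).\<close>

lemma odd_primes_mertens_shifted:
  assumes "n \<ge> 1"
  shows "2 * ln (real n) - 12 \<le> (\<Sum>p\<in>odd_primes n. 2 * ln (real p) / (real p + 1))"
proof -
  have "(\<Sum>p\<in>odd_primes n. ln (real p) / (real p * (real p - 1))) \<le> 2"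
    by (rule order_trans[OF sum_mono2 sum_ln_div_le[of n]]) (auto dest: odd_primesD)
  then have "2 * ln (real n) - 12 \<le> 2 * (\<Sum>p\<in>odd_primes n. ln (real p) / real p)
       - 2 * (\<Sum>p\<in>odd_primes n. ln (real p) / (real p * (real p - 1)))"
    using odd_primes_mertens_lower[OF assms] by linarith
  also have "\<dots> = (\<Sum>p\<in>odd_primes n. 2 * (ln (real p) / real p) - 2 * (ln (real p) / (real p * (real p - 1))))"
    by (simp add: sum_subtractf sum_distrib_left)
  also have "\<dots> \<le> (\<Sum>p\<in>odd_primes n. 2 * ln (real p) / (real p + 1))"
  proof (intro sum_mono)
    fix p assume "p \<in> odd_primes n"
    then have p: "real p \<ge> 3" by (auto dest: odd_primesD)
    have "1 / real p - 1 / (real p * (real p - 1)) \<le> 1 / (real p + 1)"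
      using p by (simp add: divide_simps) (simp add: algebra_simps)
    then have "2 * ln (real p) * (1 / real p - 1 / (real p * (real p - 1))) \<le> 2 * ln (real p) * (1 / (real p + 1))"
      using p by (intro mult_left_mono) auto
    then show "2 * (ln (real p) / real p) - 2 * (ln (real p) / (real p * (real p - 1))) \<le> 2 * ln (real p) / (real p + 1)"
      by (simp add: algebra_simps)
  qed
  finally show ?thesis .
qed

section \<open>Gallagher's larger sieve and almost periods modulo a prime\<close>

definition residue_count :: "int set \<Rightarrow> nat \<Rightarrow> int \<Rightarrow> nat" where
  "residue_count B p s = card {b\<in>B. b mod int p = s}"

definition collisions :: "int set \<Rightarrow> nat \<Rightarrow> nat" where
  "collisions B p = card {(b, b') \<in> B \<times> B. b mod int p = b' mod int p}"

lemma sum_residue_count: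
  assumes "finite B" "finite T" "\<And>b. b \<in> B \<Longrightarrow> b mod int p \<in> T"
  shows "(\<Sum>s\<in>T. residue_count B p s) = card B"
proof -
  have "(\<Sum>s\<in>T. \<Sum>b\<in>{b\<in>B. b mod int p = s}. 1) = (\<Sum>b\<in>B. (1::nat))"
    using assms by (intro sum.group) auto
  then show ?thesis by (simp add: residue_count_def)
qed

lemma collisions_eq_sum_squares:
  assumes "finite B" "finite T" "\<And>b. b \<in> B \<Longrightarrow> b mod int p \<in> T"
  shows "collisions B p = (\<Sum>s\<in>T. (residue_count B p s)\<^sup>2)"
proof -
  have "{(b, b') \<in> B \<times> B. b mod int p = b' mod int p} =
      (SIGMA b:B. {b'\<in>B. b' mod int p = b mod int p})" by auto
  then have "collisions B p = (\<Sum>b\<in>B. residue_count B p (b mod int p))"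
    using assms(1) by (simp add: collisions_def residue_count_def)
  also have "\<dots> = (\<Sum>s\<in>T. \<Sum>b\<in>{b\<in>B. b mod int p = s}. residue_count B p (b mod int p))"
    using assms by (intro sum.group[symmetric]) auto
  also have "\<dots> = (\<Sum>s\<in>T. (residue_count B p s)\<^sup>2)"
    by (simp add: power2_eq_square residue_count_def)
  finally show ?thesis .
qed

text \<open>Expand the square around the mean. Keeping the defect of Cauchy-Schwarz as an exact term
  is the point: a set for which the larger sieve is nearly sharp must have small variance modulo
  most p.\<close>

lemma collisions_variance:
  assumes "finite B" "finite T" "T \<noteq> {}" "\<And>b. b \<in> B \<Longrightarrow> b mod int p \<in> T"
  shows "real (collisions B p) = (real (card B))\<^sup>2 / real (card T) +
    (\<Sum>s\<in>T. (real (residue_count B p s) - real (card B) / real (card T))\<^sup>2)"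
proof -
  let ?n = "real (card B)" and ?t = "real (card T)"
  have t: "?t > 0" using assms by (simp add: card_gt_0_iff)
  have S: "(\<Sum>s\<in>T. real (residue_count B p s)) = ?n"
    using sum_residue_count[OF assms(1,2,4)] by (metis of_nat_sum)
  have "(\<Sum>s\<in>T. (real (residue_count B p s) - ?n / ?t)\<^sup>2) =
     (\<Sum>s\<in>T. (real (residue_count B p s))\<^sup>2) - 2 * (?n / ?t) * (\<Sum>s\<in>T. real (residue_count B p s)) + ?t * (?n / ?t)\<^sup>2"
    by (simp add: power2_diff sum.distrib sum_subtractf sum_distrib_left sum_divide_distrib mult_ac)
  also have "(\<Sum>s\<in>T. (real (residue_count B p s))\<^sup>2) = real (collisions B p)"
    using collisions_eq_sum_squares[OF assms(1,2,4)] by simp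
  finally show ?thesis using t unfolding S by (simp add: power2_eq_square field_simps)
qed

lemma collisions_ge:
  assumes "finite B" "finite T" "T \<noteq> {}" "\<And>b. b \<in> B \<Longrightarrow> b mod int p \<in> T"
  shows "(real (card B))\<^sup>2 / real (card T) \<le> real (collisions B p)"
  using collisions_variance[OF assms] by (simp add: sum_nonneg)

text \<open>Count pairs instead of primes: the primes at which b and b' with b \<noteq> b' collide
  divide b - b', so their logarithms sum to at most ln M, while a diagonal pair collides at every
  prime. Nothing is assumed about residues, so each use can insert its own lower bound for
  \<open>collisions\<close>.\<close>

lemma larger_sieve:
  fixes B :: "int set" and P :: "nat set" and M :: real
  assumes "finite B" "finite P" "\<And>p. p \<in> P \<Longrightarrow> prime p" "M \<ge> 1"
    and diam: "\<And>b b'. b \<in> B \<Longrightarrow> b' \<in> B \<Longrightarrow> \<bar>real_of_int (b - b')\<bar> \<le> M"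
  shows "(\<Sum>p\<in>P. ln (real p) * real (collisions B p)) \<le>
    (real (card B))\<^sup>2 * ln M + real (card B) * (\<Sum>p\<in>P. ln (real p))"
proof -
  let ?f = "\<lambda>x p. if fst x mod int p = snd x mod int p then ln (real p) else 0"
  have ln0: "ln (real p) \<ge> 0" if "p \<in> P" for p using assms(3)[OF that] prime_ge_1_nat by simp
  have coll: "real (collisions B p) * ln (real p) = (\<Sum>x\<in>B \<times> B. ?f x p)" for p
  proof -
    have "{(b, b') \<in> B \<times> B. b mod int p = b' mod int p} =
        (B \<times> B) \<inter> {x. fst x mod int p = snd x mod int p}" by auto
    then show ?thesis using assms(1) by (simp add: collisions_def sum.If_cases)
  qed
  have pair: "(\<Sum>p\<in>P. ?f x p) \<le> ln M + (if fst x = snd x then \<Sum>p\<in>P. ln (real p) else 0)"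
    if x: "x \<in> B \<times> B" for x
  proof (cases "fst x = snd x")
    case True
    then show ?thesis using assms(4) by simp
  next
    case False
    define d where "d = nat \<bar>fst x - snd x\<bar>"
    have d: "d > 0" using False by (simp add: d_def)
    have "(\<Sum>p\<in>P. ?f x p) = (\<Sum>p\<in>P \<inter> {p. fst x mod int p = snd x mod int p}. ln (real p))"
      using assms(2) by (simp add: sum.If_cases)
    also have "\<dots> \<le> ln (real d)"
      using assms(2,3) d
      by (intro ln_prod_primes_le) (auto simp: d_def mod_eq_dvd_iff simp flip: int_dvd_int_iff)
    also have "\<dots> \<le> ln M"
    proof -
      have "real d = \<bar>real_of_int (fst x - snd x)\<bar>" by (simp add: d_def)
      also have "\<dots> \<le> M" using diam[of "fst x" "snd x"] x by auto
      finally show ?thesis using d assms(4) by simp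
    qed
    finally show ?thesis using False by simp
  qed
  have "(\<Sum>p\<in>P. ln (real p) * real (collisions B p)) = (\<Sum>p\<in>P. \<Sum>x\<in>B \<times> B. ?f x p)"
    by (simp add: coll[symmetric] mult.commute)
  also have "\<dots> = (\<Sum>x\<in>B \<times> B. \<Sum>p\<in>P. ?f x p)" by (rule sum.swap)
  also have "\<dots> \<le> (\<Sum>x\<in>B \<times> B. ln M + (if fst x = snd x then \<Sum>p\<in>P. ln (real p) else 0))"
    by (intro sum_mono pair)
  also have "\<dots> = (real (card B))\<^sup>2 * ln M + real (card ((B \<times> B) \<inter> {x. fst x = snd x})) * (\<Sum>p\<in>P. ln (real p))"
    using assms(1) by (simp add: sum.distrib sum.If_cases power2_eq_square)
  also have "(B \<times> B) \<inter> {x. fst x = snd x} = (\<lambda>b. (b, b)) ` B" by auto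
  also have "card \<dots> = card B" by (intro card_image) (auto simp: inj_on_def)
  finally show ?thesis .
qed

text \<open>This is the size of S \<inter> (S + d) in \<int>/p. The shift is an arbitrary integer,
  so differences of sieved elements can be inserted without reduction
  (\<open>overlap_mod\<close>).\<close>

definition overlap :: "int set \<Rightarrow> nat \<Rightarrow> int \<Rightarrow> nat" where
  "overlap S p d = card {s\<in>S. (s - d) mod int p \<in> S}"

definition almost_periods :: "int set \<Rightarrow> nat \<Rightarrow> real \<Rightarrow> int set" where
  "almost_periods S p \<alpha> = {x\<in>{0..<int p}. \<alpha> * real (card S) \<le> real (overlap S p x)}"

lemma finite_almost_periods [simp]: "finite (almost_periods S p \<alpha>)"
  by (rule finite_subset[of _ "{0..<int p}"]) (auto simp: almost_periods_def)

lemma overlap_mod [simp]: "overlap S p (d mod int p) = overlap S p d"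
  unfolding overlap_def by (simp add: mod_diff_right_eq)

text \<open>A pair (s, t) of elements of S is counted at exactly one shift, x = s - t modulo
  p.\<close>

lemma sum_overlap:
  assumes "S \<subseteq> {0..<int p}"
  shows "(\<Sum>x\<in>{0..<int p}. overlap S p x) = (card S)\<^sup>2"
proof -
  have fin: "finite S" using assms finite_subset by blast
  have "(\<Sum>x\<in>{0..<int p}. overlap S p x) = (\<Sum>x\<in>{0..<int p}. \<Sum>s\<in>S. if (s - x) mod int p \<in> S then 1 else 0)"
    using fin by (simp add: overlap_def sum.If_cases Int_def)
  also have "\<dots> = (\<Sum>s\<in>S. \<Sum>x\<in>{0..<int p}. if (s - x) mod int p \<in> S then 1 else 0)" by (rule sum.swap)
  also have "\<dots> = (\<Sum>s\<in>S. card S)"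
  proof (intro sum.cong refl)
    fix s assume s: "s \<in> S"
    have "bij_betw (\<lambda>x. (s - x) mod int p) {x\<in>{0..<int p}. (s - x) mod int p \<in> S} S"
    proof (rule bij_betwI[where g = "\<lambda>t. (s - t) mod int p"])
      show "(\<lambda>t. (s - t) mod int p) \<in> S \<rightarrow> {x \<in> {0..<int p}. (s - x) mod int p \<in> S}"
        using assms s by (auto simp: mod_diff_right_eq)
    qed (use assms in \<open>auto simp: mod_diff_right_eq\<close>)
    then have "card {x\<in>{0..<int p}. (s - x) mod int p \<in> S} = card S" by (rule bij_betw_same_card)
    then show "(\<Sum>x\<in>{0..<int p}. if (s - x) mod int p \<in> S then 1 else 0) = card S"
      by (simp add: sum.If_cases Int_def)
  qed
  finally show ?thesis by (simp add: power2_eq_square)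
qed

text \<open>If \<open>2|T - T| < 3|T|\<close>, every element of \<open>T - T\<close> has more than \<open>|T|/2\<close> representations, so two
  of them share a first component and \<open>T - T\<close> is a subgroup; in \<open>\<int>/p\<close> it is then everything.\<close>

lemma card_difference_set_ge:
  fixes T :: "int set" and p :: nat
  assumes p: "prime p" and T: "T \<subseteq> {0..<int p}" "card T \<ge> 2"
    and D: "D = {(x - y) mod int p | x y. x \<in> T \<and> y \<in> T}" and ne: "D \<noteq> {0..<int p}"
  shows "3 * card T \<le> 2 * card D"
proof (rule ccontr)
  assume neg: "\<not> ?thesis"
  have p0: "int p > 0" using p prime_gt_0_nat by simp
  have finT: "finite T" using T(1) finite_subset by blast
  have Dsub: "D \<subseteq> {0..<int p}" using p0 by (auto simp: D)
  have finD: "finite D" using Dsub finite_subset by blast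
  have reps: "card T < 2 * card {t\<in>T. (t - z) mod int p \<in> T}" if "z \<in> D" for z
  proof -
    obtain a b where ab: "a \<in> T" "b \<in> T" "z = (a - b) mod int p" using \<open>z \<in> D\<close> by (auto simp: D)
    define E where "E c = (\<lambda>t. (t - c) mod int p) ` T" for c
    have cE: "card (E c) = card T" for c
      unfolding E_def
    proof (rule card_image, rule inj_onI)
      fix x y assume xy: "x \<in> T" "y \<in> T" "(x - c) mod int p = (y - c) mod int p"
      then have "x mod int p = y mod int p" by (simp add: mod_eq_dvd_iff)
      then show "x = y" using xy T by (auto simp: subset_iff)
    qed
    have E1: "E a \<subseteq> D" "E b \<subseteq> D" using ab by (auto simp: E_def D)
    have finE: "finite (E c)" for c using finT by (simp add: E_def)
    \<comment> \<open>The translates T - a and T - b lie in D, and 2|D| < 3|T|, so they meet in more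
      than |T|/2 points. A common point t - a = t' - b gives t - z = t', a representation of
      z.\<close>
    have "card (E a \<union> E b) + card (E a \<inter> E b) = 2 * card T"
      using card_Un_Int[OF finE finE, of a b] cE by simp
    moreover have "card (E a \<union> E b) \<le> card D" using E1 finD by (intro card_mono) auto
    ultimately have "card T < 2 * card (E a \<inter> E b)" using neg by linarith
    also have "E a \<inter> E b \<subseteq> (\<lambda>t. (t - a) mod int p) ` {t\<in>T. (t - z) mod int p \<in> T}"
    proof
      fix w assume "w \<in> E a \<inter> E b"
      then obtain t t' where t: "t \<in> T" "t' \<in> T" "w = (t - a) mod int p" "w = (t' - b) mod int p"
        by (auto simp: E_def)
      have "(t - z) mod int p = (t - (a - b)) mod int p" by (simp add: ab(3) mod_diff_right_eq)
      also have "\<dots> = ((t - a) mod int p + b) mod int p"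
        by (simp add: mod_add_left_eq diff_diff_eq2 add.commute[of t b] diff_add_eq)
      also have "\<dots> = ((t' - b) mod int p + b) mod int p" using t(3,4) by simp
      also have "\<dots> = t' mod int p" by (simp add: mod_add_left_eq)
      also have "\<dots> = t'" using t(2) T by (auto simp: subset_iff)
      finally show "w \<in> (\<lambda>t. (t - a) mod int p) ` {t\<in>T. (t - z) mod int p \<in> T}" using t by auto
    qed
    then have "card (E a \<inter> E b) \<le> card {t\<in>T. (t - z) mod int p \<in> T}"
      using finT by (intro order_trans[OF card_mono card_image_le]) auto
    finally show ?thesis by simp
  qed
  have closed: "(x - y) mod int p \<in> D" if "x \<in> D" "y \<in> D" for x y
  proof -
    let ?F = "\<lambda>z. {t\<in>T. (t - z) mod int p \<in> T}"
    have "?F x \<inter> ?F y \<noteq> {}"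
    proof
      assume "?F x \<inter> ?F y = {}"
      then have "card (?F x) + card (?F y) = card (?F x \<union> ?F y)" using finT by (simp add: card_Un_disjoint)
      also have "\<dots> \<le> card T" using finT by (intro card_mono) auto
      finally show False using reps[OF that(1)] reps[OF that(2)] by linarith
    qed
    then obtain t where t: "t \<in> T" "(t - x) mod int p \<in> T" "(t - y) mod int p \<in> T" by blast
    have "(x - y) mod int p = ((t - y) mod int p - (t - x) mod int p) mod int p"
      by (simp add: mod_diff_eq)
    then show ?thesis using t by (auto simp: D)
  qed
  obtain a b where ab: "a \<in> T" "b \<in> T" "a \<noteq> b"
    using T(2) by (metis card_le_Suc0_iff_eq finT not_less_eq_eq numeral_2_eq_2)
  define g where "g = (b - a) mod int p"
  have gD: "g \<in> D" using ab by (auto simp: g_def D)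
  have g0: "\<not> int p dvd g"
  proof
    assume "int p dvd g"
    then have "int p dvd b - a" by (simp add: g_def dvd_mod_iff)
    then have "a mod int p = b mod int p" by (metis mod_eq_dvd_iff)
    then show False using ab T by (auto simp: subset_iff)
  qed
  \<comment> \<open>Closure is known for subtraction only, so the multiples of \<open>g\<close> that
    induction reaches are the negative ones.\<close>
  have mult: "(- int k * g) mod int p \<in> D" for k
  proof (induction k)
    case 0 then show ?case using closed[OF gD gD] by simp
  next
    case (Suc k)
    have "((- int k * g) mod int p - g) mod int p = (- int k * g - g) mod int p"
      by (simp only: mod_diff_left_eq)
    also have "- int k * g - g = - int (Suc k) * g" by (simp add: algebra_simps)
    finally have "((- int k * g) mod int p - g) mod int p = (- int (Suc k) * g) mod int p" .
    then show ?case using closed[OF Suc gD] by simp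
  qed
  have "{0..<int p} \<subseteq> D"
  proof
    fix x assume x: "x \<in> {0..<int p}"
    have "coprime g (int p)" using prime_imp_coprime[of "int p" g] g0 p by (simp add: coprime_commute)
    then obtain h where h: "[g * h = 1] (mod int p)" using cong_solve_coprime_int by blast
    \<comment> \<open>With h inverse to g, this k solves -kg = x modulo p.\<close>
    define k where "k = nat ((- h * x) mod int p)"
    have "[int k = - h * x] (mod int p)" using p0 by (simp add: k_def Cong.cong_def)
    then have "[- int k * g = - (- h * x) * g] (mod int p)"
      by (intro cong_mult cong_refl) (simp only: cong_minus_minus_iff)
    also have "- (- h * x) * g = (g * h) * x" by simp
    also have "[(g * h) * x = 1 * x] (mod int p)" using h by (intro cong_mult cong_refl)
    finally have "(- int k * g) mod int p = x mod int p" by (simp only: Cong.cong_def mult_1)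
    then have "(- int k * g) mod int p = x" using x by simp
    then show "x \<in> D" using mult[of k] by simp
  qed
  then show False using ne Dsub by blast
qed

text \<open>Two 17/18-almost periods lose at most 1/18 of S each, so their difference keeps 8/9 of
  S. The overlaps sum to |S|^2, so at most 9/8 |S| < p shifts keep 8/9 of S. Hence T - T is not
  everything, and \<open>card_difference_set_ge\<close> gives |T| <= 2/3 * 9/8 |S| = 3/4
  |S|.\<close>

lemma card_almost_periods_le:
  assumes p: "prime p" and S: "S \<subseteq> {0..<int p}" "2 * card S = p + 1" and p3: "p \<ge> 3"
  shows "real (card (almost_periods S p (17 / 18))) \<le> 3 / 4 * real (card S)"
proof (cases "card (almost_periods S p (17 / 18)) \<ge> 2")
  case False
  \<comment> \<open>At most one almost period, and |S| >= 2 because p >= 3.\<close>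
  then show ?thesis using S(2) p3 by simp
next
  case True
  define T where "T = almost_periods S p (17 / 18)"
  define U where "U = almost_periods S p (8 / 9)"
  define D where "D = {(x - y) mod int p | x y. x \<in> T \<and> y \<in> T}"
  have p0: "int p > 0" using p3 by simp
  have finS: "finite S" using S(1) finite_subset by blast
  have "D \<subseteq> U"
  proof
    fix z assume "z \<in> D"
    then obtain x y where xy: "x \<in> T" "y \<in> T" "z = (x - y) mod int p" by (auto simp: D_def)
    let ?F = "\<lambda>c. {s\<in>S. (s - c) mod int p \<in> S}"
    have F: "17 / 18 * real (card S) \<le> real (card (?F c))" if "c \<in> T" for c
      using that by (simp add: T_def almost_periods_def overlap_def)
    have "card (?F x \<union> ?F y) + card (?F x \<inter> ?F y) = card (?F x) + card (?F y)"
      using finS by (intro card_Un_Int[symmetric]) auto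
    moreover have "card (?F x \<union> ?F y) \<le> card S" using finS by (intro card_mono) auto
    ultimately have "8 / 9 * real (card S) \<le> real (card (?F x \<inter> ?F y))"
      using F[OF xy(1)] F[OF xy(2)] by linarith
    also have "card (?F x \<inter> ?F y) \<le> overlap S p (x - y)"
      unfolding overlap_def
    proof (rule card_inj_on_le[where f = "\<lambda>s. (s - y) mod int p"])
      show "inj_on (\<lambda>s. (s - y) mod int p) (?F x \<inter> ?F y)"
      proof (rule inj_onI)
        fix s t assume st: "s \<in> ?F x \<inter> ?F y" "t \<in> ?F x \<inter> ?F y" "(s - y) mod int p = (t - y) mod int p"
        then have "s mod int p = t mod int p" by (simp add: mod_eq_dvd_iff)
        then show "s = t" using st S(1) by (auto simp: subset_iff)
      qed
      show "(\<lambda>s. (s - y) mod int p) ` (?F x \<inter> ?F y) \<subseteq> {s\<in>S. (s - (x - y)) mod int p \<in> S}"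
        by (auto simp: mod_diff_left_eq)
    qed (use finS in auto)
    finally show "z \<in> U" using p0 by (simp add: xy(3) U_def almost_periods_def)
  qed
  then have DU: "card D \<le> card U" by (intro card_mono) (auto simp: U_def)
  have "8 / 9 * real (card S) * real (card U) = (\<Sum>x\<in>U. 8 / 9 * real (card S))" by simp
  also have "\<dots> \<le> (\<Sum>x\<in>U. real (overlap S p x))"
    by (intro sum_mono) (simp add: U_def almost_periods_def)
  also have "\<dots> \<le> (\<Sum>x\<in>{0..<int p}. real (overlap S p x))"
    by (intro sum_mono2) (auto simp: U_def almost_periods_def)
  also have "\<dots> = real (card S) * real (card S)"
    using sum_overlap[OF S(1)] by (metis of_nat_mult of_nat_sum power2_eq_square)
  finally have U: "real (card U) \<le> 9 / 8 * real (card S)" using S(2) by simp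
  have ne: "D \<noteq> {0..<int p}"
  proof
    assume "D = {0..<int p}"
    then have "card D = p" by simp
    then show False using DU U S(2) p3 by linarith
  qed
  have "T \<subseteq> {0..<int p}" by (auto simp: T_def almost_periods_def)
  then have "3 * card T \<le> 2 * card D"
    using card_difference_set_ge[OF p _ _ D_def ne] True by (simp add: T_def)
  then show ?thesis using DU U by (simp add: T_def)
qed

section \<open>Fourier analysis modulo a prime\<close>

definition expsum :: "int set \<Rightarrow> real \<Rightarrow> complex" where
  "expsum B \<alpha> = (\<Sum>b\<in>B. cis (2 * pi * \<alpha> * of_int b))"

lemma cis_2pi_eq_1_iff: "cis (2 * pi * x) = 1 \<longleftrightarrow> x \<in> \<int>"
proof
  assume "cis (2 * pi * x) = 1"
  then have "cos (2 * pi * x) = 1" by (simp add: complex_eq_iff)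
  then obtain k :: int where "2 * pi * x = of_int k * 2 * pi" by (auto simp: cos_one_2pi_int)
  then have "x = of_int k" by simp
  then show "x \<in> \<int>" by simp
qed simp

text \<open>Orthogonality of the characters of \<int>/p: a geometric sum whose ratio is a p-th root
  of unity.\<close>

lemma sum_cis_multiples:
  fixes p :: nat and m :: int
  assumes "p > 0"
  shows "(\<Sum>r<p. cis (2 * pi * (real r / real p) * of_int m)) = (if int p dvd m then of_nat p else 0)"
proof -
  define z where "z = cis (2 * pi * (of_int m / real p))"
  have pw: "cis (2 * pi * (real r / real p) * of_int m) = z ^ r" for r
  proof -
    have "z ^ r = cis (real r * (2 * pi * (of_int m / real p)))" by (simp only: z_def Complex.DeMoivre)
    also have "real r * (2 * pi * (of_int m / real p)) = 2 * pi * (real r / real p) * of_int m" by simp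
    finally show ?thesis by (rule sym)
  qed
  have z1: "z = 1 \<longleftrightarrow> int p dvd m"
  proof -
    have "z = 1 \<longleftrightarrow> real_of_int m / real_of_int (int p) \<in> \<int>"
      unfolding z_def cis_2pi_eq_1_iff by simp
    also have "\<dots> \<longleftrightarrow> int p dvd m"
      using assms by (subst of_int_div_of_int_in_Ints_iff) auto
    finally show ?thesis .
  qed
  have zp: "z ^ p = 1"
  proof -
    have "z ^ p = cis (2 * pi * of_int m)" using assms by (simp add: z_def Complex.DeMoivre)
    then show ?thesis by (simp add: cis_2pi_eq_1_iff)
  qed
  show ?thesis
    unfolding pw using z1 zp by (cases "z = 1") (auto simp: sum_gp_strict)
qed

lemma norm_sum_squared:
  fixes f :: "'a \<Rightarrow> complex"
  shows "of_real ((cmod (\<Sum>i\<in>I. f i))\<^sup>2) = (\<Sum>i\<in>I. \<Sum>j\<in>I. f i * cnj (f j))"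
  by (simp only: complex_norm_square cnj_sum sum_product)

lemma cis_mult_cnj_of_int:
  "cis (\<alpha> * of_int x) * cnj (cis (\<alpha> * of_int y)) = cis (\<alpha> * of_int (x - y))"
  by (simp add: cis_cnj cis_mult right_diff_distrib)

text \<open>Indexing by \<open>I\<close> through \<open>f\<close> counts values with multiplicity,
  so that the second moment (f the identity on S) and the fourth moment (f the sum on S \<times> S)
  are both instances.\<close>

lemma parseval_multiset:
  fixes f :: "'a \<Rightarrow> int"
  assumes "p > 0" "finite I"
  shows "(\<Sum>r<p. (cmod (\<Sum>i\<in>I. cis (2 * pi * (real r / real p) * of_int (f i))))\<^sup>2) =
    real p * real (card {(i, j) \<in> I \<times> I. int p dvd f i - f j})"
proof -
  have "complex_of_real (\<Sum>r<p. (cmod (\<Sum>i\<in>I. cis (2 * pi * (real r / real p) * of_int (f i))))\<^sup>2) =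
    (\<Sum>r<p. \<Sum>i\<in>I. \<Sum>j\<in>I. cis (2 * pi * (real r / real p) * of_int (f i - f j)))"
    by (simp only: of_real_sum norm_sum_squared cis_mult_cnj_of_int)
  also have "\<dots> = (\<Sum>i\<in>I. \<Sum>r<p. \<Sum>j\<in>I. cis (2 * pi * (real r / real p) * of_int (f i - f j)))"
    by (rule sum.swap)
  also have "\<dots> = (\<Sum>i\<in>I. \<Sum>j\<in>I. \<Sum>r<p. cis (2 * pi * (real r / real p) * of_int (f i - f j)))"
    by (intro sum.cong refl sum.swap)
  also have "\<dots> = (\<Sum>i\<in>I. \<Sum>j\<in>I. if int p dvd f i - f j then of_nat p else 0)"
    by (intro sum.cong refl sum_cis_multiples assms)
  also have "\<dots> = (\<Sum>x\<in>I \<times> I. if int p dvd f (fst x) - f (snd x) then of_nat p else 0)"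
    by (simp add: sum.cartesian_product case_prod_beta)
  also have "\<dots> = of_nat p * of_nat (card ((I \<times> I) \<inter> {x. int p dvd f (fst x) - f (snd x)}))"
    using assms(2) by (simp add: sum.If_cases)
  also have "(I \<times> I) \<inter> {x. int p dvd f (fst x) - f (snd x)} = {(i, j) \<in> I \<times> I. int p dvd f i - f j}"
    by auto
  also have "of_nat p * of_nat (card {(i, j) \<in> I \<times> I. int p dvd f i - f j}) =
      complex_of_real (real p * real (card {(i, j) \<in> I \<times> I. int p dvd f i - f j}))"
    by simp
  finally show ?thesis by (simp only: of_real_eq_iff)
qed

lemma sum_expsum_squared:
  assumes "p > 0" "S \<subseteq> {0..<int p}"
  shows "(\<Sum>r<p. (cmod (expsum S (real r / real p)))\<^sup>2) = real p * real (card S)"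
proof -
  have fin: "finite S" using assms(2) finite_subset by blast
  have "{(i, j) \<in> S \<times> S. int p dvd i - j} = (\<lambda>i. (i, i)) ` S"
  proof -
    have iff: "int p dvd i - j \<longleftrightarrow> i = j" if "i \<in> S" "j \<in> S" for i j
    proof -
      have "int p dvd i - j \<longleftrightarrow> i mod int p = j mod int p" by (simp add: mod_eq_dvd_iff)
      moreover have "i mod int p = i" "j mod int p = j" using that assms(2) by auto
      ultimately show ?thesis by simp
    qed
    show ?thesis
    proof (intro equalityI subsetI)
      fix x assume "x \<in> {(i, j) \<in> S \<times> S. int p dvd i - j}"
      then obtain i j where x: "x = (i, j)" "i \<in> S" "j \<in> S" "int p dvd i - j" by blast
      then have "i = j" using iff by blast
      then show "x \<in> (\<lambda>i. (i, i)) ` S" using x by blast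
    next
      fix x assume "x \<in> (\<lambda>i. (i, i)) ` S"
      then obtain i where "x = (i, i)" "i \<in> S" by blast
      then show "x \<in> {(i, j) \<in> S \<times> S. int p dvd i - j}" by simp
    qed
  qed
  then have "card {(i, j) \<in> S \<times> S. int p dvd i - j} = card S"
    by (simp add: card_image inj_on_def)
  then show ?thesis using parseval_multiset[OF assms(1) fin, of id] by (simp add: expsum_def)
qed

text \<open>The square of \<open>expsum S\<close> is the exponential sum over S \<times> S of s +
  s', and two such sums coincide modulo p exactly at an additive quadruple.\<close>

lemma sum_expsum_fourth:
  assumes "p > 0" "S \<subseteq> {0..<int p}"
  shows "(\<Sum>r<p. (cmod (expsum S (real r / real p))) ^ 4) =
    real p * real (card (additive_quadruples p S))"
proof -
  have fin: "finite S" using assms(2) finite_subset by blast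
  let ?f = "\<lambda>x :: int \<times> int. fst x + snd x"
  let ?Q = "{(x, y) \<in> (S \<times> S) \<times> (S \<times> S). int p dvd ?f x - ?f y}"
  have sq: "(cmod (expsum S \<alpha>)) ^ 4 = (cmod (\<Sum>x\<in>S \<times> S. cis (2 * pi * \<alpha> * of_int (?f x))))\<^sup>2" for \<alpha>
  proof -
    have "(expsum S \<alpha>)\<^sup>2 = (\<Sum>x\<in>S \<times> S. cis (2 * pi * \<alpha> * of_int (?f x)))"
      by (simp add: expsum_def power2_eq_square sum_product sum.cartesian_product case_prod_beta
          cis_mult distrib_left)
    then have "cmod (\<Sum>x\<in>S \<times> S. cis (2 * pi * \<alpha> * of_int (?f x))) = (cmod (expsum S \<alpha>))\<^sup>2"
      by (metis norm_power)
    then show ?thesis by simp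
  qed
  have "bij_betw (\<lambda>(x, y). (fst x, snd x, fst y, snd y)) ?Q (additive_quadruples p S)"
    by (rule bij_betwI[where g = "\<lambda>(a, b, c, d). ((a, b), (c, d))"])
      (auto simp: additive_quadruples_def residue_ring_def mod_eq_dvd_iff)
  then have "card ?Q = card (additive_quadruples p S)" by (rule bij_betw_same_card)
  then show ?thesis
    using parseval_multiset[OF assms(1), of "S \<times> S" ?f] fin unfolding sq by simp
qed

text \<open>The frequency 0 contributes ((p+1)/2)^4, that is p^4/16 up to p^3, to the fourth moment;
  this is where 1/16 comes from. Since p >= 2/\<delta>, at least \<delta>/2 p^4 is left for the
  other frequencies. Their second moment is below p^2/4, so one of them has square at least 2
  \<delta> p^2.\<close>

lemma large_fourier_coefficient:
  fixes \<delta> :: real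
  assumes \<delta>: "\<delta> > 0" and p: "2 / \<delta> \<le> real p" "p > 0" and S: "S \<subseteq> {0..<int p}" "2 * card S = p + 1"
    and E: "(1 / 16 + \<delta>) * real p ^ 3 \<le> real (card (additive_quadruples p S))"
  obtains r where "0 < r" "r < p" "2 * \<delta> * (real p)\<^sup>2 \<le> (cmod (expsum S (real r / real p)))\<^sup>2"
proof (rule ccontr)
  note witness = that
  assume neg: "\<not> thesis"
  have small: "(cmod (expsum S (real r / real p)))\<^sup>2 \<le> 2 * \<delta> * (real p)\<^sup>2" if "0 < r" "r < p" for r
    using witness[of r] that neg by linarith
  define x where "x = real p"
  have x1: "x \<ge> 1" using p by (simp add: x_def)
  have cS: "real (card S) = (x + 1) / 2" using S(2) by (simp add: x_def)
  let ?a = "\<lambda>r. (cmod (expsum S (real r / real p)))\<^sup>2"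
  have a0: "?a 0 = (real (card S))\<^sup>2" by (simp add: expsum_def)
  have split: "sum g {..<p} = g 0 + sum g {0<..<p}" for g :: "nat \<Rightarrow> real"
  proof -
    have "{..<p} = insert 0 {0<..<p}" using p by auto
    then show ?thesis by simp
  qed
  \<comment> \<open>This is p|S| - |S|^2 with |S| = (p+1)/2. The -1 makes the inequality
    \<open>up\<close> strict, which the contradiction needs.\<close>
  have s2: "(\<Sum>r\<in>{0<..<p}. ?a r) = (x\<^sup>2 - 1) / 4"
    using sum_expsum_squared[OF p(2) S(1)] unfolding split a0 cS
    by (simp add: x_def[symmetric] power2_eq_square field_simps)
  have "(\<Sum>r\<in>{0<..<p}. (?a r)\<^sup>2) \<le> (\<Sum>r\<in>{0<..<p}. 2 * \<delta> * x\<^sup>2 * ?a r)"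
    unfolding power2_eq_square[of "?a _"]
    by (intro sum_mono mult_right_mono) (use small in \<open>auto simp: x_def\<close>)
  also have "\<dots> = 2 * \<delta> * x\<^sup>2 * ((x\<^sup>2 - 1) / 4)" unfolding s2[symmetric] by (simp add: sum_distrib_left)
  also have "\<dots> = \<delta> / 2 * x ^ 4 - \<delta> / 2 * x\<^sup>2" by (simp add: power2_eq_square power4_eq_xxxx field_simps)
  also have "\<dots> < \<delta> / 2 * x ^ 4" using \<delta> x1 by simp
  finally have up: "(\<Sum>r\<in>{0<..<p}. (?a r)\<^sup>2) < \<delta> / 2 * x ^ 4" .
  have "x * ((1 / 16 + \<delta>) * x ^ 3) \<le> x * real (card (additive_quadruples p S))"
    using E x1 by (intro mult_left_mono) (auto simp: x_def)
  also have "\<dots> = ((x + 1) / 2) ^ 4 + (\<Sum>r\<in>{0<..<p}. (?a r)\<^sup>2)"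
  proof -
    have "(cmod (expsum S (real r / real p))) ^ 4 = (?a r)\<^sup>2" for r by simp
    then have "(?a 0)\<^sup>2 + (\<Sum>r\<in>{0<..<p}. (?a r)\<^sup>2) = x * real (card (additive_quadruples p S))"
      using sum_expsum_fourth[OF p(2) S(1)] unfolding split x_def by simp
    moreover have "(?a 0)\<^sup>2 = ((x + 1) / 2) ^ 4" unfolding a0 cS by simp
    ultimately show ?thesis by linarith
  qed
  finally have low: "x * ((1 / 16 + \<delta>) * x ^ 3) \<le> ((x + 1) / 2) ^ 4 + (\<Sum>r\<in>{0<..<p}. (?a r)\<^sup>2)" .
  have "((x + 1) / 2) ^ 4 \<le> x ^ 4 / 16 + x ^ 3"
  proof -
    have "x\<^sup>2 \<le> x ^ 3" "x \<le> x ^ 3" "1 \<le> x ^ 3"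
      using x1 power_increasing[of _ 3 x] power_increasing[of 1 3 x] by auto
    moreover have "(x + 1) ^ 4 = x ^ 4 + 4 * x ^ 3 + 6 * x\<^sup>2 + 4 * x + 1"
      by (simp add: power2_eq_square power3_eq_cube power4_eq_xxxx algebra_simps)
    ultimately show ?thesis by (simp add: power_divide)
  qed
  moreover have "x ^ 3 \<le> \<delta> / 2 * x ^ 4"
  proof -
    have "1 \<le> \<delta> / 2 * x" using p(1) \<delta> by (simp add: x_def field_simps)
    then have "1 * x ^ 3 \<le> (\<delta> / 2 * x) * x ^ 3" using x1 by (intro mult_right_mono) auto
    then show ?thesis by (simp add: power3_eq_cube power4_eq_xxxx mult_ac)
  qed
  moreover have "x * ((1 / 16 + \<delta>) * x ^ 3) = x ^ 4 / 16 + \<delta> * x ^ 4"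
    by (simp add: power3_eq_cube power4_eq_xxxx algebra_simps)
  ultimately show False using low up by linarith
qed

text \<open>Replace each residue count by its mean n/|S|. The main term is then at least (n/p)
  sqrt(2 \<delta>) p = 2 sqrt(\<delta>/2) n, and by Cauchy-Schwarz and \<open>V\<close> the error is
  at most sqrt(\<delta>/2) n. The two constants are matched so that half of the main term
  survives.\<close>

lemma fourier_coefficient_transfer:
  assumes B: "finite B" "\<And>b. b \<in> B \<Longrightarrow> b mod int p \<in> S" and p: "p > 0"
    and S: "S \<subseteq> {0..<int p}" "S \<noteq> {}" and \<delta>: "\<delta> > 0"
    and r: "2 * \<delta> * (real p)\<^sup>2 \<le> (cmod (expsum S (real r / real p)))\<^sup>2"
    and V: "real p * (\<Sum>s\<in>S. (real (residue_count B p s) - real (card B) / real (card S))\<^sup>2)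
      \<le> \<delta> / 2 * (real (card B))\<^sup>2"
  shows "\<delta> / 2 * (real (card B))\<^sup>2 \<le> (cmod (expsum B (real r / real p)))\<^sup>2"
proof -
  let ?n = "real (card B)" and ?c = "real (card B) / real (card S)" and ?\<alpha> = "real r / real p"
  let ?e = "\<lambda>b::int. cis (2 * pi * ?\<alpha> * of_int b)"
  have fin: "finite S" using S(1) finite_subset by blast
  have cS: "card S > 0" "card S \<le> p"
    using S fin card_mono[of "{0..<int p}" S] by (auto simp: card_gt_0_iff)
  have per: "?e b = ?e (b mod int p)" for b
  proof -
    have "real_of_int b = real p * of_int (b div int p) + of_int (b mod int p)"
      by (metis mult_div_mod_eq of_int_add of_int_mult of_int_of_nat_eq)
    then have "2 * pi * ?\<alpha> * real_of_int b =
        2 * pi * of_int (int r * (b div int p)) + 2 * pi * ?\<alpha> * of_int (b mod int p)"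
      using p by (simp add: field_simps)
    then have "?e b = cis (2 * pi * of_int (int r * (b div int p))) * ?e (b mod int p)"
      by (simp only: cis_mult)
    then show ?thesis by (simp only: cis_multiple_2pi Ints_of_int mult_1)
  qed
  have "expsum B ?\<alpha> = (\<Sum>s\<in>S. \<Sum>b\<in>{b\<in>B. b mod int p = s}. ?e b)"
    unfolding expsum_def using B fin by (intro sum.group[symmetric]) auto
  also have "\<dots> = (\<Sum>s\<in>S. \<Sum>b\<in>{b\<in>B. b mod int p = s}. ?e s)"
    by (intro sum.cong refl) (use per in auto)
  also have "\<dots> = (\<Sum>s\<in>S. of_nat (residue_count B p s) * ?e s)"
    by (simp add: residue_count_def)
  finally have "expsum B ?\<alpha> - of_real ?c * expsum S ?\<alpha> =
      (\<Sum>s\<in>S. of_real (real (residue_count B p s) - ?c) * ?e s)"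
    by (simp add: expsum_def sum_distrib_left sum_subtractf left_diff_distrib)
  then have "cmod (expsum B ?\<alpha> - of_real ?c * expsum S ?\<alpha>) \<le>
      (\<Sum>s\<in>S. \<bar>real (residue_count B p s) - ?c\<bar>)"
    by (simp only:) (rule order_trans[OF norm_sum], simp add: norm_mult flip: of_real_diff)
  moreover have "(\<Sum>s\<in>S. \<bar>real (residue_count B p s) - ?c\<bar>)\<^sup>2 \<le> \<delta> / 2 * ?n\<^sup>2"
  proof -
    have "(\<Sum>s\<in>S. \<bar>real (residue_count B p s) - ?c\<bar>)\<^sup>2 \<le>
        (\<Sum>s\<in>S. (real (residue_count B p s) - ?c)\<^sup>2) * card S"
      using sum_squared_le_sum_of_squares[of "\<lambda>s. \<bar>real (residue_count B p s) - ?c\<bar>" S] by simp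
    also have "\<dots> \<le> (\<Sum>s\<in>S. (real (residue_count B p s) - ?c)\<^sup>2) * real p"
      using cS by (intro mult_left_mono sum_nonneg) auto
    finally show ?thesis using V by (simp add: mult.commute)
  qed
  then have "(\<Sum>s\<in>S. \<bar>real (residue_count B p s) - ?c\<bar>) \<le> sqrt (\<delta> / 2 * ?n\<^sup>2)"
    by (rule real_le_rsqrt)
  moreover have "sqrt (\<delta> / 2 * ?n\<^sup>2) = sqrt (\<delta> / 2) * ?n"
    unfolding real_sqrt_mult by simp
  ultimately have diff: "cmod (expsum B ?\<alpha> - of_real ?c * expsum S ?\<alpha>) \<le> sqrt (\<delta> / 2) * ?n"
    by simp
  have "2 * (sqrt (\<delta> / 2) * ?n) \<le> cmod (of_real ?c * expsum S ?\<alpha>)"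
  proof -
    have "sqrt (2 * \<delta> * (real p)\<^sup>2) \<le> cmod (expsum S ?\<alpha>)" using r by (intro real_le_lsqrt) auto
    moreover have "sqrt (2 * \<delta> * (real p)\<^sup>2) = 2 * sqrt (\<delta> / 2) * real p"
      using real_sqrt_mult[of 4 "\<delta> / 2"] by (simp add: real_sqrt_mult)
    ultimately have "?c * (2 * sqrt (\<delta> / 2) * real p) \<le> ?c * cmod (expsum S ?\<alpha>)"
      by (intro mult_left_mono) auto
    moreover have "?n * (2 * sqrt (\<delta> / 2)) \<le> ?c * real p * (2 * sqrt (\<delta> / 2))"
    proof (intro mult_right_mono)
      have "?c * real (card S) \<le> ?c * real p" using cS by (intro mult_left_mono) auto
      then show "?n \<le> ?c * real p" using cS by simp
    qed (use \<delta> in auto)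
    moreover have "cmod (of_real ?c * expsum S ?\<alpha>) = ?c * cmod (expsum S ?\<alpha>)"
      by (simp only: norm_mult norm_of_real) simp
    ultimately show ?thesis by (simp only: mult_ac)
  qed
  moreover have "cmod (of_real ?c * expsum S ?\<alpha>) \<le>
      cmod (expsum B ?\<alpha>) + cmod (expsum B ?\<alpha> - of_real ?c * expsum S ?\<alpha>)"
    by (metis norm_minus_commute norm_triangle_sub add.commute)
  ultimately have "sqrt (\<delta> / 2) * ?n \<le> cmod (expsum B ?\<alpha>)" using diff by linarith
  then have "(sqrt (\<delta> / 2) * ?n)\<^sup>2 \<le> (cmod (expsum B ?\<alpha>))\<^sup>2"
    using \<delta> by (intro power_mono) auto
  then show ?thesis using \<delta> by (simp add: power_mult_distrib)
qed

section \<open>A dual large sieve and popular differences\<close>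

lemma sum_inverse_nat_le:
  assumes "n \<ge> 1"
  shows "(\<Sum>k=1..n. 1 / real k) \<le> 1 + ln (real n)"
  using assms
proof (induction n rule: nat_induct_at_least)
  case (Suc n)
  have "ln (real n / (real n + 1)) \<le> real n / (real n + 1) - 1"
    using Suc.hyps by (intro ln_le_minus_one) auto
  also have "\<dots> = - (1 / (real n + 1))" by (simp add: field_simps)
  finally have "1 / (real n + 1) \<le> ln (real n + 1) - ln (real n)"
    using Suc.hyps by (simp add: ln_div)
  then show ?case using Suc by (simp add: add.commute)
qed simp

text \<open>The separation makes i \<mapsto> floor(X y_i) injective into {1..X}, which reduces the
  sum to a harmonic one.\<close>

lemma sum_inverse_separated_le:
  fixes y :: "'a \<Rightarrow> real" and X :: nat
  assumes "finite I" "X \<ge> 1"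
    and range: "\<And>i. i \<in> I \<Longrightarrow> 1 / real X \<le> y i \<and> y i \<le> 1"
    and sep: "\<And>i j. i \<in> I \<Longrightarrow> j \<in> I \<Longrightarrow> i \<noteq> j \<Longrightarrow> 1 / real X \<le> \<bar>y i - y j\<bar>"
  shows "(\<Sum>i\<in>I. 1 / y i) \<le> real X * (1 + ln (real X))"
proof -
  define b where "b i = nat \<lfloor>real X * y i\<rfloor>" for i
  have X: "real X \<ge> 1" using assms(2) by simp
  have y0: "real X * y i \<ge> 1" "real X * y i \<le> real X" if "i \<in> I" for i
    using range[OF that] X by (auto simp: field_simps mult_left_le)
  have b: "1 \<le> b i" "b i \<le> X" "real (b i) \<le> real X * y i" "real X * y i < real (b i) + 1" if "i \<in> I" for i
    using y0[OF that] unfolding b_def by linarith+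
  have inj: "inj_on b I"
  proof (rule inj_onI, rule ccontr)
    fix i j assume ij: "i \<in> I" "j \<in> I" "b i = b j" "i \<noteq> j"
    have "real X * (1 / real X) \<le> real X * \<bar>y i - y j\<bar>"
      using sep[OF ij(1,2,4)] X by (intro mult_left_mono) auto
    then have "1 \<le> \<bar>real X * y i - real X * y j\<bar>"
      using X by (simp add: abs_mult flip: right_diff_distrib)
    then show False using b(3,4)[OF ij(1)] b(3,4)[OF ij(2)] ij(3) by linarith
  qed
  have "(\<Sum>i\<in>I. 1 / y i) \<le> (\<Sum>i\<in>I. real X * (1 / real (b i)))"
  proof (rule sum_mono)
    fix i assume i: "i \<in> I"
    have "y i > 0" using range[OF i] X by (smt (verit) divide_pos_pos)
    then show "1 / y i \<le> real X * (1 / real (b i))" using b(1,3)[OF i] by (simp add: field_simps)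
  qed
  also have "\<dots> = real X * (\<Sum>k\<in>b ` I. 1 / real k)"
    by (simp add: sum.reindex[OF inj] sum_distrib_left)
  also have "\<dots> \<le> real X * (\<Sum>k=1..X. 1 / real k)"
    using b by (intro mult_left_mono sum_mono2) auto
  also have "\<dots> \<le> real X * (1 + ln (real X))"
    using sum_inverse_nat_le[OF assms(2)] by (intro mult_left_mono) auto
  finally show ?thesis .
qed

text \<open>The norm equals 2 |sin(pi x)|, and sine lies above its chord on [0, pi/2] by concavity,
  used here as convexity of -sin.\<close>

lemma norm_one_minus_cis_ge:
  assumes "0 < x" "x < 1"
  shows "4 * min x (1 - x) \<le> cmod (1 - cis (2 * pi * x))"
proof -
  have half: "2 * y \<le> sin (pi * y)" if "0 \<le> y" "y \<le> 1 / 2" for y :: real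
  proof -
    have "convex_on {0..pi / 2} (\<lambda>x. - sin x)"
      by (rule f''_ge0_imp_convex[where f' = "\<lambda>x. - cos x" and f'' = sin])
        (auto intro!: derivative_eq_intros sin_ge_zero)
    then have "- sin ((1 - 2 * y) *\<^sub>R 0 + (2 * y) *\<^sub>R (pi / 2)) \<le> (1 - 2 * y) * (- sin 0) + 2 * y * (- sin (pi / 2))"
      using that by (intro convex_onD) auto
    then show ?thesis by (simp add: mult_ac)
  qed
  have "(cmod (1 - cis (2 * pi * x)))\<^sup>2 = (2 * sin (pi * x))\<^sup>2"
  proof -
    have "cos (2 * pi * x) = 1 - 2 * (sin (pi * x))\<^sup>2" using cos_double_sin[of "pi * x"] by (simp add: mult_ac)
    moreover have "(cmod (1 - cis (2 * pi * x)))\<^sup>2 = 2 - 2 * cos (2 * pi * x)"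
      using sin_cos_squared_add[of "2 * pi * x"] by (simp add: cmod_power2 power2_diff)
    ultimately show ?thesis by (simp add: power_mult_distrib)
  qed
  then have "cmod (1 - cis (2 * pi * x)) = 2 * \<bar>sin (pi * x)\<bar>"
    using power2_eq_iff_nonneg[of "cmod (1 - cis (2 * pi * x))" "2 * \<bar>sin (pi * x)\<bar>"]
    by (simp add: power_mult_distrib)
  moreover have "2 * min x (1 - x) \<le> sin (pi * x)"
  proof (cases "x \<le> 1 / 2")
    case True then show ?thesis using half[of x] assms by simp
  next
    case False
    have "sin (pi * (1 - x)) = sin (pi * x)" by (simp add: right_diff_distrib)
    then show ?thesis using half[of "1 - x"] assms False by simp
  qed
  ultimately show ?thesis by linarith
qed

text \<open>The geometric sum is at most 2/|1 - z|, hence 1/(2 min x (1-x)). The minimum is replaced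
  by a sum of reciprocals so that x and 1 - x can be summed separately over separated
  points.\<close>

lemma norm_geometric_sum_le:
  fixes X :: nat
  assumes "0 < x" "x < 1"
  shows "cmod (\<Sum>d\<in>{- int X..int X}. cis (2 * pi * x * of_int d)) \<le> (1 / x + 1 / (1 - x)) / 2"
proof -
  define z where "z = cis (2 * pi * x)"
  have m0: "min x (1 - x) > 0" using assms by simp
  have lb: "4 * min x (1 - x) \<le> cmod (1 - z)" using norm_one_minus_cis_ge[OF assms] by (simp add: z_def)
  then have z1: "z \<noteq> 1" using m0 by auto
  have "(\<Sum>d\<in>{- int X..int X}. cis (2 * pi * x * of_int d)) =
     (\<Sum>k<2 * X + 1. cis (- 2 * pi * x * real X) * z ^ k)"
  proof (rule sum.reindex_bij_witness[where i = "\<lambda>k. int k - int X" and j = "\<lambda>d. nat (d + int X)"])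
    fix d assume d: "d \<in> {- int X..int X}"
    have "z ^ nat (d + int X) = cis (real (nat (d + int X)) * (2 * pi * x))"
      by (simp only: z_def Complex.DeMoivre)
    also have "real (nat (d + int X)) = of_int d + real X" using d by simp
    finally show "cis (- 2 * pi * x * real X) * z ^ nat (d + int X) = cis (2 * pi * x * of_int d)"
      by (simp add: cis_mult algebra_simps)
  qed auto
  also have "\<dots> = cis (- 2 * pi * x * real X) * ((1 - z ^ (2 * X + 1)) / (1 - z))"
    using z1 by (simp only: sum_distrib_left[symmetric] sum_gp_strict if_False)
  also have "cmod \<dots> \<le> 2 / cmod (1 - z)"
  proof -
    have "cmod (1 - z ^ (2 * X + 1)) \<le> 2"
      by (rule order_trans[OF norm_triangle_ineq4]) (simp add: norm_power norm_mult z_def)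
    then show ?thesis by (simp add: norm_mult norm_divide divide_right_mono)
  qed
  also have "\<dots> \<le> 2 / (4 * min x (1 - x))"
    using lb m0 by (intro divide_left_mono) (auto intro!: mult_pos_pos)
  also have "\<dots> \<le> (1 / x + 1 / (1 - x)) / 2"
    using assms by (auto simp: min_def divide_simps)
  finally show ?thesis .
qed

text \<open>The numerator rq - sp - kpq is a nonzero integer, since p divides neither r nor q, and
  the denominator pq is at most X.\<close>

lemma frac_fraction_separated:
  fixes p q X :: nat and r s :: nat and \<alpha> :: real
  assumes "prime p" "prime q" "p \<noteq> q" "p * q \<le> X" "0 < r" "r < p"
  shows "1 / real X \<le> \<bar>real r / real p - real s / real q - of_int k\<bar>"
proof -
  have pq: "real p > 0" "real q > 0" "p * q > 0" using assms prime_gt_0_nat by auto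
  define m where "m = int r * int q - int s * int p - k * int p * int q"
  have "m \<noteq> 0"
  proof
    assume "m = 0"
    then have "int r * int q = int p * (int s + k * int q)" by (simp add: m_def algebra_simps)
    then have "int p dvd int (r * q)" by simp
    then have "p dvd r * q" by (simp only: int_dvd_int_iff)
    moreover have "\<not> p dvd r" using assms by (simp add: nat_dvd_not_less)
    moreover have "\<not> p dvd q" using assms primes_dvd_imp_eq by blast
    ultimately show False using assms(1) prime_dvd_mult_iff by blast
  qed
  then have m1: "1 \<le> \<bar>real_of_int m\<bar>" by linarith
  have "real r / real p - real s / real q - of_int k = of_int m / (real p * real q)"
    using pq by (simp add: m_def field_simps)
  then have "\<bar>real r / real p - real s / real q - of_int k\<bar> = \<bar>of_int m\<bar> / (real p * real q)"
    using pq by (simp add: abs_mult)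
  moreover have "1 / real X \<le> \<bar>of_int m\<bar> / (real p * real q)"
  proof -
    have "real p * real q \<le> real X" using assms(4) by (metis of_nat_le_iff of_nat_mult)
    then show ?thesis using m1 pq by (intro frac_le) auto
  qed
  ultimately show ?thesis by simp
qed

text \<open>The frequencies are \<open>1/X\<close>-separated modulo 1. The loss of a logarithm is harmless below.\<close>

lemma dual_large_sieve:
  fixes P :: "nat set" and r :: "nat \<Rightarrow> nat" and X :: nat
  assumes "finite P" "X \<ge> 1" and P: "\<And>p. p \<in> P \<Longrightarrow> prime p"
    and r: "\<And>p. p \<in> P \<Longrightarrow> 0 < r p \<and> r p < p"
    and pq: "\<And>p q. p \<in> P \<Longrightarrow> q \<in> P \<Longrightarrow> p * q \<le> X"
  shows "(\<Sum>d\<in>{- int X..int X}. (cmod (\<Sum>p\<in>P. cis (2 * pi * (real (r p) / real p) * of_int d)))\<^sup>2)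
    \<le> real (card P) * (real X * (4 + ln (real X)))"
proof -
  define \<theta> where "\<theta> p = real (r p) / real p" for p
  let ?G = "\<lambda>d::int. \<Sum>p\<in>P. cis (2 * pi * \<theta> p * of_int d)"
  let ?K = "\<lambda>x. \<Sum>d\<in>{- int X..int X}. cis (2 * pi * x * of_int d)"
  have sep: "1 / real X \<le> \<bar>\<theta> p - \<theta> q - of_int k\<bar>" if "p \<in> P" "q \<in> P" "p \<noteq> q" for p q k
    unfolding \<theta>_def using that P r pq by (intro frac_fraction_separated) auto
  have X: "real X \<ge> 1" using assms(2) by simp
  have "complex_of_real (\<Sum>d\<in>{- int X..int X}. (cmod (?G d))\<^sup>2) =
      (\<Sum>d\<in>{- int X..int X}. \<Sum>p\<in>P. \<Sum>q\<in>P. cis (2 * pi * (\<theta> q - \<theta> p) * of_int d))"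
    unfolding of_real_sum norm_sum_squared
    by (subst (2) sum.swap) (simp add: cis_cnj cis_mult algebra_simps)
  also have "\<dots> = (\<Sum>p\<in>P. \<Sum>d\<in>{- int X..int X}. \<Sum>q\<in>P. cis (2 * pi * (\<theta> q - \<theta> p) * of_int d))"
    by (rule sum.swap)
  also have "\<dots> = (\<Sum>p\<in>P. \<Sum>q\<in>P. ?K (\<theta> q - \<theta> p))"
    by (intro sum.cong refl sum.swap)
  finally have eq: "complex_of_real (\<Sum>d\<in>{- int X..int X}. (cmod (?G d))\<^sup>2) = (\<Sum>p\<in>P. \<Sum>q\<in>P. ?K (\<theta> q - \<theta> p))" .
  \<comment> \<open>Bounding each row of the kernel suffices: the diagonal gives at most 2X + 1, and
    each of the two families y and 1 - y gives at most X (1 + ln X), of which the mean is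
    taken.\<close>
  have row: "cmod (\<Sum>q\<in>P. ?K (\<theta> q - \<theta> p)) \<le> real X * (4 + ln (real X))" if p: "p \<in> P" for p
  proof -
    define y where "y q = frac (\<theta> q - \<theta> p)" for q
    have yk: "y q = \<theta> q - \<theta> p - of_int \<lfloor>\<theta> q - \<theta> p\<rfloor>" for q by (simp add: y_def frac_def)
    have y01: "0 \<le> y q" "y q < 1" for q by (auto simp: y_def frac_lt_1)
    have y: "1 / real X \<le> y q" "1 / real X \<le> 1 - y q" if "q \<in> P - {p}" for q
    proof -
      have "1 / real X \<le> \<bar>y q\<bar>" using sep[of q p "\<lfloor>\<theta> q - \<theta> p\<rfloor>"] that p unfolding yk by auto
      then show "1 / real X \<le> y q" using y01[of q] by simp
      \<comment> \<open>Distance to the next integer: the same separation with k larger by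
        one.\<close>
      have "1 / real X \<le> \<bar>\<theta> q - \<theta> p - of_int (\<lfloor>\<theta> q - \<theta> p\<rfloor> + 1)\<bar>"
        using that p by (intro sep) auto
      also have "\<theta> q - \<theta> p - of_int (\<lfloor>\<theta> q - \<theta> p\<rfloor> + 1) = y q - 1" unfolding yk by simp
      finally show "1 / real X \<le> 1 - y q" using y01[of q] by simp
    qed
    have X0: "1 / real X > 0" using X by simp
    have ysep: "1 / real X \<le> \<bar>y q - y q'\<bar>" if "q \<in> P - {p}" "q' \<in> P - {p}" "q \<noteq> q'" for q q'
    proof -
      have "y q - y q' = \<theta> q - \<theta> q' - of_int (\<lfloor>\<theta> q - \<theta> p\<rfloor> - \<lfloor>\<theta> q' - \<theta> p\<rfloor>)"
        unfolding yk by simp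
      moreover have "1 / real X \<le> \<bar>\<theta> q - \<theta> q' - of_int (\<lfloor>\<theta> q - \<theta> p\<rfloor> - \<lfloor>\<theta> q' - \<theta> p\<rfloor>)\<bar>"
        using that by (intro sep) auto
      ultimately show ?thesis by (simp only:)
    qed
    have K: "cmod (?K (\<theta> q - \<theta> p)) \<le> (1 / y q + 1 / (1 - y q)) / 2" if q: "q \<in> P - {p}" for q
    proof -
      have "?K (\<theta> q - \<theta> p) = ?K (y q)"
      proof (rule sum.cong[OF refl])
        fix d :: int
        have "2 * pi * (\<theta> q - \<theta> p) * of_int d = 2 * pi * y q * of_int d + 2 * pi * of_int (\<lfloor>\<theta> q - \<theta> p\<rfloor> * d)"
          unfolding yk by (simp add: algebra_simps)
        then have "cis (2 * pi * (\<theta> q - \<theta> p) * of_int d) = cis (2 * pi * y q * of_int d) * cis (2 * pi * of_int (\<lfloor>\<theta> q - \<theta> p\<rfloor> * d))"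
          by (simp only: cis_mult)
        then show "cis (2 * pi * (\<theta> q - \<theta> p) * of_int d) = cis (2 * pi * y q * of_int d)"
          by (simp only: cis_multiple_2pi Ints_of_int mult_1_right)
      qed
      then show ?thesis using norm_geometric_sum_le[of "y q" X] y[OF q] X0 by (simp only:)
    qed
    have K0: "cmod (?K (\<theta> p - \<theta> p)) \<le> 2 * real X + 1"
      by (rule order_trans[OF norm_sum]) simp
    have "cmod (\<Sum>q\<in>P. ?K (\<theta> q - \<theta> p)) \<le> (\<Sum>q\<in>P. cmod (?K (\<theta> q - \<theta> p)))" by (rule norm_sum)
    also have "\<dots> = cmod (?K (\<theta> p - \<theta> p)) + (\<Sum>q\<in>P - {p}. cmod (?K (\<theta> q - \<theta> p)))"
      using assms(1) p by (rule sum.remove)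
    also have "\<dots> \<le> (2 * real X + 1) + (\<Sum>q\<in>P - {p}. (1 / y q + 1 / (1 - y q)) / 2)"
      by (intro add_mono sum_mono K K0)
    also have "(\<Sum>q\<in>P - {p}. (1 / y q + 1 / (1 - y q)) / 2) =
        ((\<Sum>q\<in>P - {p}. 1 / y q) + (\<Sum>q\<in>P - {p}. 1 / (1 - y q))) / 2"
      by (simp add: sum.distrib flip: sum_divide_distrib)
    also have "\<dots> \<le> (real X * (1 + ln (real X)) + real X * (1 + ln (real X))) / 2"
    proof (intro divide_right_mono add_mono sum_inverse_separated_le)
      fix q q' assume "q \<in> P - {p}" "q' \<in> P - {p}" "q \<noteq> q'"
      then show "1 / real X \<le> \<bar>y q - y q'\<bar>" "1 / real X \<le> \<bar>1 - y q - (1 - y q')\<bar>"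
        using ysep[of q q'] by auto
    qed (use assms(1,2) y y01 in \<open>auto intro: less_imp_le\<close>)
    finally have "cmod (\<Sum>q\<in>P. ?K (\<theta> q - \<theta> p)) \<le> 2 * real X + 1 +
        (real X * (1 + ln (real X)) + real X * (1 + ln (real X))) / 2"
      by simp
    also have "\<dots> \<le> real X * (4 + ln (real X))" using X by (simp add: field_simps)
    finally show ?thesis .
  qed
  have "(\<Sum>d\<in>{- int X..int X}. (cmod (?G d))\<^sup>2) = cmod (complex_of_real (\<Sum>d\<in>{- int X..int X}. (cmod (?G d))\<^sup>2))"
    by (simp only: norm_of_real abs_of_nonneg sum_nonneg zero_le_power2)
  also have "\<dots> \<le> (\<Sum>p\<in>P. cmod (\<Sum>q\<in>P. ?K (\<theta> q - \<theta> p)))" unfolding eq by (rule norm_sum)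
  also have "\<dots> \<le> (\<Sum>p\<in>P. real X * (4 + ln (real X)))" by (intro sum_mono row)
  also have "\<dots> = real (card P) * (real X * (4 + ln (real X)))" by simp
  finally show ?thesis unfolding \<theta>_def .
qed

section \<open>From large Fourier coefficients to popular differences\<close>

definition difference_count :: "int set \<Rightarrow> int \<Rightarrow> nat" where
  "difference_count B d = card {b\<in>B. b - d \<in> B}"

lemma sum_difference_count:
  fixes f :: "int \<Rightarrow> 'a::comm_semiring_1"
  assumes "finite B" "finite D" "\<And>b b'. b \<in> B \<Longrightarrow> b' \<in> B \<Longrightarrow> b - b' \<in> D"
  shows "(\<Sum>b\<in>B. \<Sum>b'\<in>B. f (b - b')) = (\<Sum>d\<in>D. of_nat (difference_count B d) * f d)"
proof -
  have "(\<Sum>b\<in>B. \<Sum>b'\<in>B. f (b - b')) = (\<Sum>x\<in>B \<times> B. f (fst x - snd x))"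
    by (simp add: sum.cartesian_product case_prod_beta)
  also have "\<dots> = (\<Sum>d\<in>D. \<Sum>x\<in>{x\<in>B \<times> B. fst x - snd x = d}. f (fst x - snd x))"
    using assms by (intro sum.group[symmetric]) auto
  also have "\<dots> = (\<Sum>d\<in>D. of_nat (card {x\<in>B \<times> B. fst x - snd x = d}) * f d)"
    by (intro sum.cong refl) simp
  finally have "(\<Sum>b\<in>B. \<Sum>b'\<in>B. f (b - b')) =
      (\<Sum>d\<in>D. of_nat (card {x\<in>B \<times> B. fst x - snd x = d}) * f d)" .
  moreover have "card {x\<in>B \<times> B. fst x - snd x = d} = difference_count B d" for d
  proof -
    have "bij_betw fst {x\<in>B \<times> B. fst x - snd x = d} {b\<in>B. b - d \<in> B}"
      by (rule bij_betwI[where g = "\<lambda>b. (b, b - d)"]) auto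
    then show ?thesis unfolding difference_count_def by (rule bij_betw_same_card)
  qed
  ultimately show ?thesis by simp
qed

text \<open>Let R(d) count representations of d, G(d) be the sum of e(d r_p/p) over P, and N = |P|.
  Expanding the |\<open>expsum\<close>|^2 over P gives N \<eta> n^2 <= |\<Sum> R(d) G(d)|. The d
  with R(d) <= \<tau> contribute at most half of this, by Cauchy-Schwarz and the dual large sieve;
  the condition on \<tau> says just that. Each remaining d contributes at most nN, so there are at
  least \<eta> n/2 of them.\<close>

lemma many_popular_differences:
  fixes B :: "int set" and P :: "nat set" and r :: "nat \<Rightarrow> nat" and X :: nat and \<eta> \<tau> :: real
  assumes B: "B \<subseteq> {1..int X}" "B \<noteq> {}" and X: "X \<ge> 1" and P: "finite P" "P \<noteq> {}" "\<And>p. p \<in> P \<Longrightarrow> prime p"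
    and r: "\<And>p. p \<in> P \<Longrightarrow> 0 < r p \<and> r p < p"
    and pq: "\<And>p q. p \<in> P \<Longrightarrow> q \<in> P \<Longrightarrow> p * q \<le> X"
    and large: "\<And>p. p \<in> P \<Longrightarrow> \<eta> * (real (card B))\<^sup>2 \<le> (cmod (expsum B (real (r p) / real p)))\<^sup>2"
    and \<eta>: "\<eta> > 0" and \<tau>: "\<tau> \<ge> 0"
      "\<tau> * (real X * (4 + ln (real X))) \<le> \<eta>\<^sup>2 / 4 * real (card P) * (real (card B))\<^sup>2"
  shows "\<eta> / 2 * real (card B) \<le> real (card {d\<in>{- int X..int X}. \<tau> < real (difference_count B d)})"
proof -
  define n where "n = real (card B)"
  define N where "N = real (card P)"
  define \<theta> where "\<theta> p = real (r p) / real p" for p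
  let ?G = "\<lambda>d::int. \<Sum>p\<in>P. cis (2 * pi * \<theta> p * of_int d)"
  let ?D = "{- int X..int X}"
  let ?R = "\<lambda>d. real (difference_count B d)"
  let ?pop = "{d\<in>?D. \<tau> < ?R d}"
  let ?unpop = "{d\<in>?D. \<not> \<tau> < ?R d}"
  have finB: "finite B" using B(1) finite_subset by blast
  have n0: "n > 0" using finB B(2) by (simp add: n_def card_gt_0_iff)
  have N0: "N > 0" using P by (simp add: N_def card_gt_0_iff)
  have diffD: "b - b' \<in> ?D" if "b \<in> B" "b' \<in> B" for b b'
  proof -
    have "1 \<le> b" "b \<le> int X" "1 \<le> b'" "b' \<le> int X" using that B(1) by auto
    then show ?thesis by simp
  qed
  have Dsplit: "sum g ?D = sum g ?pop + sum g ?unpop" for g :: "int \<Rightarrow> real"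
  proof -
    have fin: "finite ?pop" "finite ?unpop" by (auto intro: finite_subset[of _ ?D])
    have eq: "?pop \<union> ?unpop = ?D" by blast
    have "sum g (?pop \<union> ?unpop) = sum g ?pop + sum g ?unpop"
      by (rule sum.union_disjoint[OF fin]) blast
    then show ?thesis unfolding eq .
  qed
  have Rn: "?R d \<le> n" for d
    unfolding n_def difference_count_def of_nat_le_iff using finB by (intro card_mono) auto
  have GN: "cmod (?G d) \<le> N" for d
    unfolding N_def by (rule order_trans[OF norm_sum]) simp
  have sumR: "(\<Sum>d\<in>?D. ?R d) = n\<^sup>2"
    using sum_difference_count[OF finB _ diffD, where f = "\<lambda>_. 1 :: real"]
    by (simp add: n_def power2_eq_square)
  have "N * (\<eta> * n\<^sup>2) = (\<Sum>p\<in>P. \<eta> * n\<^sup>2)" by (simp add: N_def)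
  also have "\<dots> \<le> (\<Sum>p\<in>P. (cmod (expsum B (\<theta> p)))\<^sup>2)"
    unfolding \<theta>_def n_def by (intro sum_mono large)
  also have "\<dots> = cmod (complex_of_real (\<Sum>p\<in>P. (cmod (expsum B (\<theta> p)))\<^sup>2))"
    by (simp only: norm_of_real abs_of_nonneg sum_nonneg zero_le_power2)
  also have "complex_of_real (\<Sum>p\<in>P. (cmod (expsum B (\<theta> p)))\<^sup>2) =
      (\<Sum>p\<in>P. \<Sum>b\<in>B. \<Sum>b'\<in>B. cis (2 * pi * \<theta> p * of_int (b - b')))"
    unfolding of_real_sum expsum_def norm_sum_squared cis_mult_cnj_of_int ..
  also have "\<dots> = (\<Sum>b\<in>B. \<Sum>p\<in>P. \<Sum>b'\<in>B. cis (2 * pi * \<theta> p * of_int (b - b')))"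
    by (rule sum.swap)
  also have "\<dots> = (\<Sum>b\<in>B. \<Sum>b'\<in>B. ?G (b - b'))"
    by (intro sum.cong refl sum.swap)
  also have "\<dots> = (\<Sum>d\<in>?D. of_nat (difference_count B d) * ?G d)"
    by (rule sum_difference_count[OF finB _ diffD]) simp
  also have "cmod \<dots> \<le> (\<Sum>d\<in>?D. ?R d * cmod (?G d))"
    by (rule order_trans[OF norm_sum]) (simp add: norm_mult)
  also have "\<dots> = (\<Sum>d\<in>?pop. ?R d * cmod (?G d)) + (\<Sum>d\<in>?unpop. ?R d * cmod (?G d))"
    by (rule Dsplit)
  also have "(\<Sum>d\<in>?pop. ?R d * cmod (?G d)) \<le> (\<Sum>d\<in>?pop. n * N)"
    by (intro sum_mono mult_mono Rn GN) (use n0 in auto)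
  finally have main: "N * (\<eta> * n\<^sup>2) \<le> real (card ?pop) * (n * N) + (\<Sum>d\<in>?unpop. ?R d * cmod (?G d))"
    by simp
  have "(\<Sum>d\<in>?unpop. ?R d * cmod (?G d))\<^sup>2 \<le> (\<Sum>d\<in>?unpop. (?R d)\<^sup>2) * (\<Sum>d\<in>?unpop. (cmod (?G d))\<^sup>2)"
    by (rule Cauchy_Schwarz_ineq_sum)
  also have "\<dots> \<le> (\<tau> * n\<^sup>2) * (N * (real X * (4 + ln (real X))))"
  proof (rule mult_mono)
    \<comment> \<open>On unpopular differences one factor R(d) is at most \<tau>, and the other sums
      to at most n^2.\<close>
    have "(\<Sum>d\<in>?unpop. (?R d)\<^sup>2) \<le> (\<Sum>d\<in>?unpop. \<tau> * ?R d)"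
      unfolding power2_eq_square by (intro sum_mono mult_right_mono) auto
    also have "\<dots> \<le> (\<Sum>d\<in>?D. \<tau> * ?R d)" using \<tau>(1) by (intro sum_mono2) auto
    also have "\<dots> = \<tau> * n\<^sup>2" by (simp only: sum_distrib_left[symmetric] sumR)
    finally show "(\<Sum>d\<in>?unpop. (?R d)\<^sup>2) \<le> \<tau> * n\<^sup>2" .
    have "(\<Sum>d\<in>?unpop. (cmod (?G d))\<^sup>2) \<le> (\<Sum>d\<in>?D. (cmod (?G d))\<^sup>2)" by (intro sum_mono2) auto
    also have "\<dots> \<le> N * (real X * (4 + ln (real X)))"
      unfolding \<theta>_def N_def using P r pq X by (intro dual_large_sieve) auto
    finally show "(\<Sum>d\<in>?unpop. (cmod (?G d))\<^sup>2) \<le> N * (real X * (4 + ln (real X)))" .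
  qed (use \<tau>(1) in \<open>auto intro: sum_nonneg\<close>)
  also have "\<dots> = (n\<^sup>2 * N) * (\<tau> * (real X * (4 + ln (real X))))" by simp
  also have "\<dots> \<le> (n\<^sup>2 * N) * (\<eta>\<^sup>2 / 4 * N * n\<^sup>2)"
    using \<tau>(2) N0 by (intro mult_left_mono) (auto simp: n_def N_def)
  also have "\<dots> = (\<eta> / 2 * n * (n * N))\<^sup>2" by (simp add: power2_eq_square)
  finally have "(\<Sum>d\<in>?unpop. ?R d * cmod (?G d)) \<le> \<eta> / 2 * n * (n * N)"
    by (rule power2_le_imp_le) (use n0 N0 \<eta> in auto)
  then have "N * (\<eta> * n\<^sup>2) \<le> real (card ?pop) * (n * N) + \<eta> / 2 * n * (n * N)" using main by linarith
  then have "(\<eta> / 2 * n) * (n * N) \<le> real (card ?pop) * (n * N)" by (simp add: power2_eq_square algebra_simps)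
  then have "\<eta> / 2 * n \<le> real (card ?pop)" using n0 N0 by simp
  then show ?thesis by (simp add: n_def)
qed

section \<open>Sets occupying half of the residue classes\<close>

text \<open>\<open>B\<close> stands for A[X] moved to the integers. The count of additive quadruples
  is kept out of the locale and enters in \<open>card_le_of_energy\<close>.\<close>

locale half_sieved =
  fixes X R :: nat and S :: "nat \<Rightarrow> int set" and B :: "int set"
  assumes B: "B \<subseteq> {1..int X}" and X: "X \<ge> 1"
    and R: "R = nat \<lfloor>sqrt (real X)\<rfloor>"
    and S: "\<And>p. p \<in> odd_primes R \<Longrightarrow> S p \<subseteq> {0..<int p}"
    and card_S: "\<And>p. p \<in> odd_primes R \<Longrightarrow> 2 * card (S p) = p + 1"
    and residues: "\<And>p b. p \<in> odd_primes R \<Longrightarrow> b \<in> B \<Longrightarrow> b mod int p \<in> S p"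
begin

text \<open>The unnormalised Cauchy-Schwarz defect of \<open>collisions_variance\<close>: zero
  exactly when \<open>C\<close> is equidistributed on \<open>S p\<close>.\<close>

definition variance :: "int set \<Rightarrow> nat \<Rightarrow> real" where
  "variance C p = (\<Sum>s\<in>S p. (real (residue_count C p s) - real (card C) / real (card (S p)))\<^sup>2)"

lemma finite_B: "finite B"
  using B finite_subset by blast

lemma finite_S: "p \<in> odd_primes R \<Longrightarrow> finite (S p)"
  using S finite_subset by blast

lemma real_card_S: "p \<in> odd_primes R \<Longrightarrow> real (card (S p)) = (real p + 1) / 2"
proof -
  assume "p \<in> odd_primes R"
  then have "real (2 * card (S p)) = real (p + 1)" by (simp only: card_S)
  then show ?thesis by simp
qed

lemma S_nonempty: "p \<in> odd_primes R \<Longrightarrow> S p \<noteq> {}"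
  using card_S[of p] by auto

lemma diff_le: "b \<in> B \<Longrightarrow> b' \<in> B \<Longrightarrow> \<bar>real_of_int (b - b')\<bar> \<le> real X"
proof -
  assume "b \<in> B" "b' \<in> B"
  then have "1 \<le> b" "b \<le> int X" "1 \<le> b'" "b' \<le> int X" using B by auto
  then have "\<bar>b - b'\<bar> \<le> int X" by simp
  then have "real_of_int \<bar>b - b'\<bar> \<le> real_of_int (int X)" by (simp only: of_int_le_iff)
  then show "\<bar>real_of_int (b - b')\<bar> \<le> real X" by simp
qed

lemma odd_primes_mono: "Q \<le> R \<Longrightarrow> p \<in> odd_primes Q \<Longrightarrow> p \<in> odd_primes R"
  by (auto simp: odd_primes_def)

lemma real_R_le: "real R \<le> sqrt (real X)"
  unfolding R by simp

lemma real_R_ge: "sqrt (real X) / 2 \<le> real R"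
proof -
  have "sqrt (real X) \<ge> 1" using X by simp
  moreover have "real R = of_int \<lfloor>sqrt (real X)\<rfloor>" unfolding R by simp
  moreover have "1 \<le> real_of_int \<lfloor>sqrt (real X)\<rfloor>" using \<open>sqrt (real X) \<ge> 1\<close> by simp
  moreover have "sqrt (real X) < real_of_int \<lfloor>sqrt (real X)\<rfloor> + 1" by simp
  ultimately show ?thesis by linarith
qed

text \<open>The larger sieve with the defect kept on the left. \<open>M\<close> and \<open>Q\<close>
  are both free: \<open>card_le_sqrt\<close> shrinks the diameter at Q = R, while
  \<open>sum_variance_le\<close> keeps M = X and lowers Q below the size of the set.\<close>

lemma larger_sieve_variance:
  assumes C: "C \<subseteq> B" and Q: "1 \<le> Q" "Q \<le> R" and M: "M \<ge> 1"
    and diam: "\<And>b b'. b \<in> C \<Longrightarrow> b' \<in> C \<Longrightarrow> \<bar>real_of_int (b - b')\<bar> \<le> M"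
  shows "(real (card C))\<^sup>2 * (2 * ln (real Q) - 12) + (\<Sum>p\<in>odd_primes Q. ln (real p) * variance C p)
    \<le> (real (card C))\<^sup>2 * ln M + 2 * real Q * real (card C)"
proof -
  let ?n = "real (card C)"
  have finC: "finite C" using C finite_B finite_subset by blast
  have "(\<Sum>p\<in>odd_primes Q. ln (real p) * real (collisions C p)) =
     (\<Sum>p\<in>odd_primes Q. ?n\<^sup>2 * (2 * ln (real p) / (real p + 1)) + ln (real p) * variance C p)"
  proof (intro sum.cong refl)
    fix p assume "p \<in> odd_primes Q"
    then have p: "p \<in> odd_primes R" using odd_primes_mono Q by blast
    have "real (collisions C p) = ?n\<^sup>2 / real (card (S p)) + variance C p"
      unfolding variance_def using residues[OF p] C
      by (intro collisions_variance finC finite_S[OF p] S_nonempty[OF p]) auto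
    then have "real (collisions C p) = ?n\<^sup>2 / ((real p + 1) / 2) + variance C p"
      unfolding real_card_S[OF p] .
    then show "ln (real p) * real (collisions C p) =
        ?n\<^sup>2 * (2 * ln (real p) / (real p + 1)) + ln (real p) * variance C p"
      by (simp add: algebra_simps)
  qed
  also have "\<dots> = ?n\<^sup>2 * (\<Sum>p\<in>odd_primes Q. 2 * ln (real p) / (real p + 1)) +
      (\<Sum>p\<in>odd_primes Q. ln (real p) * variance C p)"
    by (simp only: sum.distrib sum_distrib_left)
  finally have "?n\<^sup>2 * (\<Sum>p\<in>odd_primes Q. 2 * ln (real p) / (real p + 1)) +
      (\<Sum>p\<in>odd_primes Q. ln (real p) * variance C p) \<le>
      ?n\<^sup>2 * ln M + ?n * (\<Sum>p\<in>odd_primes Q. ln (real p))"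
    using larger_sieve[OF finC finite_odd_primes _ M diam, of Q] odd_primesD by metis
  moreover have "?n\<^sup>2 * (2 * ln (real Q) - 12) \<le> ?n\<^sup>2 * (\<Sum>p\<in>odd_primes Q. 2 * ln (real p) / (real p + 1))"
    by (intro mult_left_mono odd_primes_mertens_shifted Q) auto
  moreover have "?n * (\<Sum>p\<in>odd_primes Q. ln (real p)) \<le> ?n * (2 * real Q)"
    by (intro mult_left_mono odd_primes_theta) auto
  ultimately show ?thesis by (simp add: mult_ac)
qed

lemma variance_nonneg: "variance C p \<ge> 0"
  by (simp add: variance_def sum_nonneg)

text \<open>Cutting \<open>[1,X]\<close> into \<open>O(1)\<close> intervals gains a constant in \<open>ln M\<close>, which absorbs all the
  constants of the larger sieve although only primes up to \<open>\<surd>X\<close> are available.\<close>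

lemma card_le_sqrt:
  assumes X15: "exp 15 \<le> real X"
  shows "real (card B) \<le> 2 * (exp 15 + 1) * sqrt (real X)"
proof -
  \<comment> \<open>The 15 beats the loss 14 = 12 + 2 from Mertens and from rounding sqrt X down to
    \<open>R\<close>. The surplus of 1 leaves n^2 <= 2Rn on each interval.\<close>
  define M where "M = real X * exp (- 15)"
  have M1: "M \<ge> 1" using X15 by (simp add: M_def exp_minus field_simps)
  define J where "J = nat \<lfloor>exp (15 :: real)\<rfloor>"
  define C where "C j = {b\<in>B. \<lfloor>of_int b / M\<rfloor> = int j}" for j :: nat
  have XM: "real X = exp 15 * M" by (simp add: M_def exp_minus field_simps)
  have "B \<subseteq> (\<Union>j\<in>{..J}. C j)"
  proof
    fix b assume b: "b \<in> B"
    then have "1 \<le> b" "b \<le> int X" using B by auto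
    then have b': "0 \<le> real_of_int b" "real_of_int b \<le> real X" by linarith+
    have "real_of_int b / M \<le> exp 15" using b'(2) M1 by (simp add: XM divide_le_eq)
    then have "\<lfloor>real_of_int b / M\<rfloor> \<le> \<lfloor>exp (15 :: real)\<rfloor>" by (rule floor_mono)
    moreover have "0 \<le> \<lfloor>real_of_int b / M\<rfloor>" using b'(1) M1 by simp
    ultimately have "nat \<lfloor>real_of_int b / M\<rfloor> \<in> {..J}" "b \<in> C (nat \<lfloor>real_of_int b / M\<rfloor>)"
      using b by (auto simp: J_def C_def)
    then show "b \<in> (\<Union>j\<in>{..J}. C j)" by blast
  qed
  moreover have finC: "finite (C j)" for j using finite_B by (simp add: C_def)
  ultimately have "card B \<le> (\<Sum>j\<in>{..J}. card (C j))"
    by (intro order_trans[OF card_mono card_UN_le]) auto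
  then have "real (card B) \<le> (\<Sum>j\<in>{..J}. real (card (C j)))" by (simp flip: of_nat_sum)
  also have "\<dots> \<le> (\<Sum>j\<in>{..J}. 2 * sqrt (real X))"
  proof (intro sum_mono)
    fix j
    let ?n = "real (card (C j))"
    have R1: "R \<ge> 1"
    proof -
      have "real R > 0" using real_R_ge X by (smt (verit) half_gt_zero of_nat_1 of_nat_le_iff real_sqrt_gt_zero)
      then show ?thesis by simp
    qed
    have lnR: "ln (real X) - 2 \<le> 2 * ln (real R)"
    proof -
      have "ln (sqrt (real X) / 2) \<le> ln (real R)" using real_R_ge X by (intro ln_mono) auto
      then show ?thesis using X ln_2_less_1 by (simp add: ln_div ln_sqrt)
    qed
    have "\<bar>real_of_int (b - b')\<bar> \<le> M" if "b \<in> C j" "b' \<in> C j" for b b'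
    proof -
      have "\<lfloor>real_of_int b / M\<rfloor> = \<lfloor>real_of_int b' / M\<rfloor>" using that by (simp add: C_def)
      then have "\<bar>real_of_int b / M - real_of_int b' / M\<bar> \<le> 1" by linarith
      then have "\<bar>(real_of_int b - real_of_int b') / M\<bar> \<le> 1" by (simp add: diff_divide_distrib)
      then show ?thesis using M1 by (simp add: abs_divide)
    qed
    then have "?n\<^sup>2 * (2 * ln (real R) - 12) + (\<Sum>p\<in>odd_primes R. ln (real p) * variance (C j) p)
        \<le> ?n\<^sup>2 * ln M + 2 * real R * ?n"
      using R1 M1 by (intro larger_sieve_variance) (auto simp: C_def)
    moreover have "(\<Sum>p\<in>odd_primes R. ln (real p) * variance (C j) p) \<ge> 0"
      by (intro sum_nonneg mult_nonneg_nonneg variance_nonneg) (auto dest: odd_primesD)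
    moreover have "ln M = ln (real X) - 15" using X by (simp add: M_def ln_mult)
    moreover have "?n\<^sup>2 * (ln (real X) - 14) \<le> ?n\<^sup>2 * (2 * ln (real R) - 12)"
      using lnR by (intro mult_left_mono) auto
    ultimately have "?n\<^sup>2 * (ln (real X) - 14) \<le> ?n\<^sup>2 * (ln (real X) - 15) + 2 * real R * ?n" by simp
    then have "?n * ?n \<le> (2 * real R) * ?n" by (simp add: algebra_simps power2_eq_square)
    then have "?n \<le> 2 * real R" by (cases "card (C j) = 0") auto
    then show "?n \<le> 2 * sqrt (real X)" using real_R_le by linarith
  qed
  also have "\<dots> = 2 * (real J + 1) * sqrt (real X)" by simp
  also have "\<dots> \<le> 2 * (exp 15 + 1) * sqrt (real X)"
    by (intro mult_right_mono mult_left_mono add_right_mono) (auto simp: J_def)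
  finally show ?thesis .
qed


text \<open>The exponent \<open>1/500\<close> is small enough for the main terms to contradict each other: the larger sieve
  for \<open>D\<close> would require \<open>4/3 (1 - 1/250 - 34/250) ln X \<le> ln X + O(1)\<close>.\<close>

lemma few_popular_differences:
  assumes L: "5200 \<le> ln (real X)"
    and D: "D = {d\<in>{- int X..int X}. real X powr (1 / 2 - 1 / 500) < real (difference_count B d)}"
  shows "real (card D) < real X powr (1 / 2 - 1 / 500)"
proof (rule ccontr)
  assume many: "\<not> ?thesis"
  define \<tau> where "\<tau> = real X powr (1 / 2 - 1 / 500)"
  \<comment> \<open>Both \<open>D\<close> and every B \<inter> (B + d) with d in \<open>D\<close>
    have at least \<tau> elements, so with this cutoff the diagonal terms of the sieve are at most
    twice a square of their sizes.\<close>
  define Q where "Q = nat \<lfloor>\<tau>\<rfloor>"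
  define w where "w p = 2 * ln (real p) / (real p + 1)" for p :: nat
  define m where "m = real (card D)"
  let ?P = "odd_primes Q"
  let ?L = "ln (real X)"
  have m: "\<tau> \<le> m" using many by (simp add: \<tau>_def m_def)
  have X1: "real X \<ge> 1" using X by simp
  have \<tau>1: "\<tau> \<ge> 1" unfolding \<tau>_def using X1 by (intro ge_one_powr_ge_zero) auto
  have Q1: "Q \<ge> 1" using \<tau>1 unfolding Q_def by linarith
  have Q\<tau>: "real Q \<le> \<tau>" using \<tau>1 by (simp add: Q_def)
  have QR: "Q \<le> R"
  proof -
    have "\<tau> \<le> sqrt (real X)"
      unfolding \<tau>_def using X1 by (simp add: powr_half_sqrt[symmetric] powr_mono)
    then show ?thesis unfolding Q_def R by (intro nat_mono floor_mono)
  qed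
  have lnQ: "2 * ln (real Q) \<ge> (1 - 1 / 250) * ?L - 2"
  proof -
    have "1 \<le> real_of_int \<lfloor>\<tau>\<rfloor>" "\<tau> < real_of_int \<lfloor>\<tau>\<rfloor> + 1" "real Q = of_int \<lfloor>\<tau>\<rfloor>"
      using \<tau>1 by (auto simp: Q_def)
    then have "\<tau> / 2 \<le> real Q" by linarith
    then have "ln (\<tau> / 2) \<le> ln (real Q)" using \<tau>1 by (intro ln_mono) auto
    moreover have "ln (\<tau> / 2) = (1 / 2 - 1 / 500) * ?L - ln 2"
      using \<tau>1 X1 by (simp add: ln_div \<tau>_def ln_powr)
    ultimately show ?thesis using ln_2_less_1 by (simp add: algebra_simps)
  qed
  have W: "(1 - 1 / 250) * ?L - 14 \<le> (\<Sum>p\<in>?P. w p)"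
    using odd_primes_mertens_shifted[OF Q1] lnQ unfolding w_def by linarith
  have w0: "w p \<ge> 0" if "p \<in> ?P" for p using odd_primesD[OF that] by (simp add: w_def)
  have PR: "p \<in> odd_primes R" if "p \<in> ?P" for p using odd_primes_mono[OF QR that] .
  have finD: "finite D" unfolding D by (rule finite_subset[of _ "{- int X..int X}"]) auto
  define bad where "bad d p \<longleftrightarrow> real (overlap (S p) p d) < 17 / 18 * real (card (S p))" for d p
  \<comment> \<open>Elements of B \<inter> (B + d) lie in S_p \<inter> (S_p + d) modulo p. At a bad
    prime this has fewer than 17/18 |S_p| classes, so the weight grows by at least 1/17 of itself,
    while the sieve allows a total of only L + 2.\<close>
  have bad_weight: "(\<Sum>p\<in>?P. if bad d p then w p else 0) \<le> 17 * (?L / 250 + 16)" if d: "d \<in> D" for d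
  proof -
    define A where "A = {b\<in>B. b - d \<in> B}"
    let ?a = "real (card A)"
    have a\<tau>: "\<tau> < ?a" using d unfolding D A_def difference_count_def \<tau>_def by simp
    have finA: "finite A" using finite_B by (simp add: A_def)
    have A0: "A \<noteq> {}" using a\<tau> \<tau>1 by auto
    have ov: "overlap (S p) p d > 0 \<and> ?a\<^sup>2 / real (overlap (S p) p d) \<le> real (collisions A p)"
      if p: "p \<in> ?P" for p
    proof -
      let ?T = "{s\<in>S p. (s - d) mod int p \<in> S p}"
      have T: "b mod int p \<in> ?T" if "b \<in> A" for b
      proof -
        have "b mod int p \<in> S p" "(b - d) mod int p \<in> S p"
          using that residues[OF PR[OF p]] by (auto simp: A_def)
        then show ?thesis by (simp add: mod_diff_left_eq)
      qed
      then have T0: "?T \<noteq> {}" using A0 by blast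
      have finT: "finite ?T" using finite_S[OF PR[OF p]] by simp
      show ?thesis using collisions_ge[OF finA finT T0 T] T0 finT
        unfolding overlap_def by (simp only: card_gt_0_iff) blast
    qed
    have "(\<Sum>p\<in>?P. ?a\<^sup>2 * (w p + (if bad d p then w p / 17 else 0))) \<le>
        (\<Sum>p\<in>?P. ln (real p) * real (collisions A p))"
    proof (intro sum_mono)
      fix p assume p: "p \<in> ?P"
      have ln0: "ln (real p) \<ge> 0" and p3: "p \<ge> 3" using odd_primesD[OF p] by auto
      have cS: "real (card (S p)) = (real p + 1) / 2" by (rule real_card_S[OF PR[OF p]])
      have o0: "real (overlap (S p) p d) > 0" using ov[OF p] by simp
      have oS: "real (overlap (S p) p d) \<le> real (card (S p))"
        unfolding overlap_def of_nat_le_iff using finite_S[OF PR[OF p]] by (intro card_mono) auto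
      have "w p + (if bad d p then w p / 17 else 0) \<le> ln (real p) / real (overlap (S p) p d)"
      proof (cases "bad d p")
        case True
        have "w p + w p / 17 = ln (real p) / (17 / 18 * real (card (S p)))"
        proof -
          have scale: "2 * l / q + 2 * l / q / 17 = l / (17 / 18 * (q / 2))" if "q > 0" for l q :: real
            using that by (simp add: field_simps)
          show ?thesis unfolding w_def cS by (rule scale) simp
        qed
        also have "\<dots> \<le> ln (real p) / real (overlap (S p) p d)"
          using True o0 ln0 by (intro divide_left_mono) (auto simp: bad_def)
        finally show ?thesis using True by simp
      next
        case False
        have "w p = ln (real p) / real (card (S p))" using p3 by (simp add: w_def cS field_simps)
        also have "\<dots> \<le> ln (real p) / real (overlap (S p) p d)"
          using oS o0 ln0 by (intro divide_left_mono) auto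
        finally show ?thesis using False by simp
      qed
      then have "?a\<^sup>2 * (w p + (if bad d p then w p / 17 else 0)) \<le> ?a\<^sup>2 * (ln (real p) / real (overlap (S p) p d))"
        by (intro mult_left_mono) auto
      also have "\<dots> = ln (real p) * (?a\<^sup>2 / real (overlap (S p) p d))" by simp
      also have "\<dots> \<le> ln (real p) * real (collisions A p)"
        using ov[OF p] ln0 by (intro mult_left_mono) auto
      finally show "?a\<^sup>2 * (w p + (if bad d p then w p / 17 else 0)) \<le> ln (real p) * real (collisions A p)" .
    qed
    also have "\<dots> \<le> ?a\<^sup>2 * ?L + ?a * (\<Sum>p\<in>?P. ln (real p))"
      using X1 diff_le by (intro larger_sieve finA) (auto dest: odd_primesD simp: A_def)
    also have "\<dots> \<le> ?a\<^sup>2 * ?L + ?a * (2 * ?a)"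
      using odd_primes_theta[of Q] Q\<tau> a\<tau> by (intro add_left_mono mult_left_mono) auto
    also have "\<dots> = ?a\<^sup>2 * (?L + 2)" by (simp add: power2_eq_square algebra_simps)
    finally have "?a\<^sup>2 * (\<Sum>p\<in>?P. w p + (if bad d p then w p / 17 else 0)) \<le> ?a\<^sup>2 * (?L + 2)"
      by (simp only: sum_distrib_left)
    then have "(\<Sum>p\<in>?P. w p + (if bad d p then w p / 17 else 0)) \<le> ?L + 2"
      using a\<tau> \<tau>1 by simp
    moreover have "(\<Sum>p\<in>?P. w p + (if bad d p then w p / 17 else 0)) =
        (\<Sum>p\<in>?P. w p) + (\<Sum>p\<in>?P. if bad d p then w p else 0) / 17"
      unfolding sum.distrib sum_divide_distrib by (intro arg_cong2[where f = "(+)"] sum.cong) auto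
    ultimately have le: "(\<Sum>p\<in>?P. w p) + (\<Sum>p\<in>?P. if bad d p then w p else 0) / 17 \<le> ?L + 2"
      by (simp only:)
    have "y \<le> 17 * (l / 250 + 16)" if "x + y / 17 \<le> l + 2" "(1 - 1 / 250) * l - 14 \<le> x" for x y l :: real
      using that by (simp add: field_simps)
    then show ?thesis using le W by blast
  qed
  define g where "g p = real (card {d\<in>D. \<not> bad d p})" for p
  have g: "m - g p = (\<Sum>d\<in>D. if bad d p then 1 else 0)" for p
  proof -
    have "card D = card {d\<in>D. \<not> bad d p} + card {d\<in>D. bad d p}"
      using finD by (subst card_Un_disjoint[symmetric]) (auto intro: arg_cong[where f = card])
    then show ?thesis using finD by (simp add: m_def g_def sum.If_cases Int_def)
  qed
  have total_bad: "(\<Sum>p\<in>?P. w p * (m - g p)) \<le> m * (17 * (?L / 250 + 16))"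
  proof -
    have "(\<Sum>p\<in>?P. w p * (m - g p)) = (\<Sum>p\<in>?P. \<Sum>d\<in>D. if bad d p then w p else 0)"
      unfolding g sum_distrib_left by (intro sum.cong refl) auto
    also have "\<dots> = (\<Sum>d\<in>D. \<Sum>p\<in>?P. if bad d p then w p else 0)" by (rule sum.swap)
    also have "\<dots> \<le> (\<Sum>d\<in>D. 17 * (?L / 250 + 16))" by (intro sum_mono bad_weight)
    finally show ?thesis by (simp add: m_def)
  qed
  \<comment> \<open>The d that are good at p reduce to almost periods of S_p, at most 3/4 |S_p|
    classes. This is the source of the factor 4/3.\<close>
  have coll: "4 / 3 * (w p * (g p)\<^sup>2) \<le> ln (real p) * real (collisions D p)" if p: "p \<in> ?P" for p
  proof (cases "g p = 0")
    case True then show ?thesis using odd_primesD[OF p] by simp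
  next
    case False
    have p': "prime p" "p \<ge> 3" using odd_primesD[OF p] by auto
    let ?D = "{d\<in>D. \<not> bad d p}" and ?T = "almost_periods (S p) p (17 / 18)"
    have T: "d mod int p \<in> ?T" if "d \<in> ?D" for d
      using that p' by (auto simp: bad_def almost_periods_def)
    have "?D \<noteq> {}" using False unfolding g_def by (metis card.empty of_nat_0)
    then have T0: "?T \<noteq> {}" using T by blast
    have cT: "real (card ?T) > 0" using T0 by (simp add: card_gt_0_iff)
    have "real (card ?T) \<le> 3 / 4 * ((real p + 1) / 2)"
      using card_almost_periods_le[OF p'(1) S[OF PR[OF p]] card_S[OF PR[OF p]] p'(2)]
      unfolding real_card_S[OF PR[OF p]] .
    then have "(g p)\<^sup>2 / (3 / 4 * ((real p + 1) / 2)) \<le> (g p)\<^sup>2 / real (card ?T)"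
      using cT by (intro divide_left_mono) auto
    also have "\<dots> \<le> real (collisions ?D p)"
      unfolding g_def using finD T0 T by (intro collisions_ge) auto
    also have "\<dots> \<le> real (collisions D p)"
    proof -
      have "finite {(b, b') \<in> D \<times> D. b mod int p = b' mod int p}"
        by (rule finite_subset[of _ "D \<times> D"]) (use finD in auto)
      then show ?thesis unfolding collisions_def of_nat_le_iff by (rule card_mono) auto
    qed
    finally have "ln (real p) * ((g p)\<^sup>2 / (3 / 4 * ((real p + 1) / 2))) \<le> ln (real p) * real (collisions D p)"
      using p' by (intro mult_left_mono) auto
    then show ?thesis by (simp add: w_def mult_ac)
  qed
  \<comment> \<open>Linearisation: (m - g)^2 >= 0 gives g^2 >= m^2 - 2m(m - g), and the weighted sum
    of m - g is what \<open>total_bad\<close> controls.\<close>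
  have "4 / 3 * (m\<^sup>2 * (\<Sum>p\<in>?P. w p) - 2 * m * (\<Sum>p\<in>?P. w p * (m - g p))) =
      (\<Sum>p\<in>?P. 4 / 3 * (w p * (m\<^sup>2 - 2 * m * (m - g p))))"
  proof -
    have "(\<Sum>p\<in>?P. 4 / 3 * (w p * (m\<^sup>2 - 2 * m * (m - g p)))) =
        (\<Sum>p\<in>?P. 4 / 3 * m\<^sup>2 * w p - 8 / 3 * m * (w p * (m - g p)))"
      by (intro sum.cong refl) (simp add: field_simps power2_eq_square)
    also have "\<dots> = 4 / 3 * m\<^sup>2 * (\<Sum>p\<in>?P. w p) - 8 / 3 * m * (\<Sum>p\<in>?P. w p * (m - g p))"
      by (simp only: sum_subtractf sum_distrib_left)
    finally show ?thesis by (simp add: algebra_simps)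
  qed
  also have "\<dots> \<le> (\<Sum>p\<in>?P. ln (real p) * real (collisions D p))"
  proof (intro sum_mono)
    fix p assume p: "p \<in> ?P"
    have "m\<^sup>2 - 2 * m * (m - g p) \<le> (g p)\<^sup>2"
      using zero_le_power2[of "m - g p"] by (simp add: power2_eq_square algebra_simps)
    then have "4 / 3 * (w p * (m\<^sup>2 - 2 * m * (m - g p))) \<le> 4 / 3 * (w p * (g p)\<^sup>2)"
      using w0[OF p] by (intro mult_left_mono) auto
    then show "4 / 3 * (w p * (m\<^sup>2 - 2 * m * (m - g p))) \<le> ln (real p) * real (collisions D p)"
      using coll[OF p] by linarith
  qed
  also have "\<dots> \<le> m\<^sup>2 * ln (2 * real X) + m * (\<Sum>p\<in>?P. ln (real p))"
    unfolding m_def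
  proof (rule larger_sieve[OF finD finite_odd_primes])
    fix b b' assume "b \<in> D" "b' \<in> D"
    then have "\<bar>b - b'\<bar> \<le> 2 * int X" unfolding D by auto
    then have "real_of_int \<bar>b - b'\<bar> \<le> real_of_int (2 * int X)" by (simp only: of_int_le_iff)
    then show "\<bar>real_of_int (b - b')\<bar> \<le> 2 * real X" by simp
  qed (use X1 in \<open>auto dest: odd_primesD\<close>)
  also have "\<dots> \<le> m\<^sup>2 * (?L + 1) + m * (2 * m)"
  proof (intro add_mono mult_left_mono)
    show "ln (2 * real X) \<le> ?L + 1" using X1 ln_2_less_1 by (simp add: ln_mult)
    show "(\<Sum>p\<in>?P. ln (real p)) \<le> 2 * m" using odd_primes_theta[of Q] Q\<tau> m by linarith
  qed (auto simp: m_def)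
  also have "\<dots> = m\<^sup>2 * (?L + 3)" by (simp add: power2_eq_square algebra_simps)
  finally have up: "4 / 3 * (m\<^sup>2 * (\<Sum>p\<in>?P. w p) - 2 * m * (\<Sum>p\<in>?P. w p * (m - g p))) \<le> m\<^sup>2 * (?L + 3)" .
  have lo: "m\<^sup>2 * ((1 - 1 / 250) * ?L - 14) \<le> m\<^sup>2 * (\<Sum>p\<in>?P. w p)" using W by (intro mult_left_mono) auto
  have hi: "2 * m * (\<Sum>p\<in>?P. w p * (m - g p)) \<le> 2 * m * (m * (17 * (?L / 250 + 16)))"
    using total_bad by (intro mult_left_mono) (auto simp: m_def)
  have "4 / 3 * (m\<^sup>2 * ((1 - 1 / 250) * ?L - 14) - 2 * m * (m * (17 * (?L / 250 + 16)))) \<le> m\<^sup>2 * (?L + 3)"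
  proof -
    have "4 / 3 * (a' - b') \<le> r" if "a' \<le> a" "b \<le> b'" "4 / 3 * (a - b) \<le> r" for a a' b b' r :: real
      using that by (simp add: field_simps)
    then show ?thesis using up lo hi by blast
  qed
  then have "m\<^sup>2 * (4 / 3 * ((1 - 1 / 250) * ?L - 14 - 2 * (17 * (?L / 250 + 16)))) \<le> m\<^sup>2 * (?L + 3)"
    by (simp add: power2_eq_square algebra_simps)
  then have "4 / 3 * ((1 - 1 / 250) * ?L - 14 - 2 * (17 * (?L / 250 + 16))) \<le> ?L + 3"
    using m \<tau>1 by simp
  \<comment> \<open>The coefficient on the left is 4/3 * 215/250 = 86/75 > 1 and the constants add
    up to 747, so L <= 747 * 75/11, which is below 5200.\<close>
  then show False using L by (simp add: field_simps)
qed


text \<open>Taking Q = min R n keeps 2Qn <= 2n^2 and loses only 2 \<kappa> L + O(1) in 2 ln Q. The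
  sieve then leaves 2 \<kappa> L + 16 for the variance, and \<kappa> L >= 1 absorbs the 16.\<close>

lemma sum_variance_le:
  assumes n: "real X powr (1 / 2 - \<kappa>) < real (card B)" and \<kappa>: "0 < \<kappa>" "\<kappa> \<le> 1 / 4" "1 \<le> \<kappa> * ln (real X)"
  obtains Q where "1 \<le> Q" "Q \<le> R" "(1 / 2 - \<kappa>) * ln (real X) - 1 \<le> ln (real Q)"
    "(\<Sum>p\<in>odd_primes Q. ln (real p) * variance B p) \<le> 18 * \<kappa> * ln (real X) * (real (card B))\<^sup>2"
proof -
  define y where "y = real X powr (1 / 2 - \<kappa>)"
  define Q where "Q = min R (card B)"
  let ?L = "ln (real X)" and ?n = "real (card B)"
  have X1: "real X \<ge> 1" using X by simp
  have y1: "y \<ge> 1" unfolding y_def using X1 \<kappa> by (intro ge_one_powr_ge_zero) auto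
  have "y \<le> sqrt (real X)" unfolding y_def using X1 \<kappa> by (simp add: powr_half_sqrt[symmetric] powr_mono)
  then have yQ: "y / 2 \<le> real Q" using real_R_ge n y1 unfolding Q_def y_def by (simp add: min_def)
  then have Q1: "1 \<le> Q" using y1 by (cases Q) auto
  have lnQ: "(1 / 2 - \<kappa>) * ?L - 1 \<le> ln (real Q)"
  proof -
    have "ln (y / 2) \<le> ln (real Q)" using yQ y1 by (intro ln_mono) auto
    moreover have "ln (y / 2) = (1 / 2 - \<kappa>) * ?L - ln 2" using y1 X1 by (simp add: ln_div y_def ln_powr)
    ultimately show ?thesis using ln_2_less_1 by linarith
  qed
  have "?n\<^sup>2 * (2 * ln (real Q) - 12) + (\<Sum>p\<in>odd_primes Q. ln (real p) * variance B p)
      \<le> ?n\<^sup>2 * ?L + 2 * real Q * ?n"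
    using Q1 X1 diff_le by (intro larger_sieve_variance) (auto simp: Q_def)
  moreover have "2 * real Q * ?n \<le> ?n\<^sup>2 * 2"
    using mult_right_mono[of "real Q" ?n "2 * ?n"] by (simp add: Q_def power2_eq_square)
  moreover have "?n\<^sup>2 * ((1 - 2 * \<kappa>) * ?L - 14) \<le> ?n\<^sup>2 * (2 * ln (real Q) - 12)"
    using lnQ by (intro mult_left_mono) (auto simp: algebra_simps)
  ultimately have "(\<Sum>p\<in>odd_primes Q. ln (real p) * variance B p) \<le> ?n\<^sup>2 * (2 * \<kappa> * ?L + 16)"
    by (simp add: algebra_simps)
  also have "\<dots> \<le> ?n\<^sup>2 * (18 * \<kappa> * ?L)" using \<kappa>(3) by (intro mult_left_mono) auto
  finally show ?thesis using that[of Q] Q1 lnQ by (simp add: Q_def mult_ac)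
qed

text \<open>A budget of Mertens weights ln p/p: the odd primes up to Q carry at least (1/2 -
  \<kappa>) L - 5, those up to y = X^(499/1000) at most 499/1000 L + 2, and those of large variance
  at most 36/100000 L. At least 1 remains. Each remaining prime exceeds y and so weighs at most L/y,
  which forces at least y/L of them.\<close>

lemma many_good_primes:
  assumes n: "real X powr (1 / 2 - \<delta>\<^sup>2 / 100000) < real (card B)"
    and \<delta>: "0 < \<delta>" "\<delta> \<le> 1" "1 \<le> \<delta>\<^sup>2 / 100000 * ln (real X)" and L: "20000 \<le> ln (real X)"
  obtains P where "P \<subseteq> odd_primes R" "real X powr (499 / 1000) \<le> real (card P) * ln (real X)"
    "\<And>p. p \<in> P \<Longrightarrow> real X powr (499 / 1000) < real p"
    "\<And>p. p \<in> P \<Longrightarrow> real p * variance B p \<le> \<delta> / 2 * (real (card B))\<^sup>2"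
proof -
  let ?L = "ln (real X)" and ?n = "real (card B)"
  define \<kappa> where "\<kappa> = \<delta>\<^sup>2 / 100000"
  have \<delta>2: "\<delta>\<^sup>2 \<le> \<delta>" using \<delta> by (simp add: power2_eq_square mult_left_le)
  have \<kappa>: "0 < \<kappa>" "\<kappa> \<le> 1 / 100000" using \<delta> \<delta>2 by (auto simp: \<kappa>_def)
  obtain Q where Q: "1 \<le> Q" "Q \<le> R" "(1 / 2 - \<kappa>) * ?L - 1 \<le> ln (real Q)"
    "(\<Sum>p\<in>odd_primes Q. ln (real p) * variance B p) \<le> 18 * \<kappa> * ?L * ?n\<^sup>2"
    using sum_variance_le[of \<kappa>] n \<delta>(3) \<kappa> unfolding \<kappa>_def by auto
  define y where "y = real X powr (499 / 1000)"
  define Y where "Y = nat \<lfloor>y\<rfloor>"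
  have X1: "real X \<ge> 1" using X by simp
  have y1: "y \<ge> 1" unfolding y_def using X1 by (intro ge_one_powr_ge_zero) auto
  have Y: "1 \<le> Y" "real Y \<le> y" "y < real Y + 1" using y1 unfolding Y_def by linarith+
  have n0: "?n > 0" using n by (smt (verit) powr_ge_zero)
  define bad where "bad = {p\<in>odd_primes Q. \<delta> / 2 * ?n\<^sup>2 < real p * variance B p}"
  define P where "P = odd_primes Q - odd_primes Y - bad"
  have ln0: "ln (real p) / real p \<ge> 0" if "p \<in> odd_primes N" for p N using odd_primesD[OF that] by simp
  have bad_weight: "(\<Sum>p\<in>bad. ln (real p) / real p) \<le> 36 / 100000 * ?L"
  proof -
    have "(\<delta> / 2 * ?n\<^sup>2) * (\<Sum>p\<in>bad. ln (real p) / real p) = (\<Sum>p\<in>bad. (\<delta> / 2 * ?n\<^sup>2) * (ln (real p) / real p))"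
      by (simp only: sum_distrib_left)
    also have "\<dots> \<le> (\<Sum>p\<in>bad. ln (real p) * variance B p)"
    proof (rule sum_mono)
      fix p assume p: "p \<in> bad"
      then have "p \<in> odd_primes Q" by (simp add: bad_def)
      then have p3: "p \<ge> 3" and l: "ln (real p) / real p \<ge> 0" using odd_primesD ln0 by auto
      have "(\<delta> / 2 * ?n\<^sup>2) * (ln (real p) / real p) \<le> (real p * variance B p) * (ln (real p) / real p)"
        using p l by (intro mult_right_mono) (auto simp: bad_def)
      then show "(\<delta> / 2 * ?n\<^sup>2) * (ln (real p) / real p) \<le> ln (real p) * variance B p"
        using p3 by (simp add: mult_ac)
    qed
    also have "\<dots> \<le> (\<Sum>p\<in>odd_primes Q. ln (real p) * variance B p)"
      by (intro sum_mono2 mult_nonneg_nonneg variance_nonneg) (auto simp: bad_def dest: odd_primesD)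
    also have "\<dots> \<le> 18 * \<kappa> * ?L * ?n\<^sup>2" by (rule Q(4))
    \<comment> \<open>Here \<delta>^2 <= \<delta> leaves one factor \<delta>, which cancels against
      the threshold \<delta>/2 in \<open>bad\<close>.\<close>
    also have "\<dots> \<le> 18 * (\<delta> / 100000) * ?L * ?n\<^sup>2"
      using \<delta>2 L by (intro mult_right_mono mult_left_mono) (auto simp: \<kappa>_def)
    also have "\<dots> = (\<delta> / 2 * ?n\<^sup>2) * (36 / 100000 * ?L)" by simp
    finally show ?thesis using \<delta>(1) n0 by (subst (asm) mult_le_cancel_left_pos) auto
  qed
  have finbad: "finite bad" by (rule finite_subset[OF _ finite_odd_primes[of Q]]) (auto simp: bad_def)
  have finP: "finite P" by (simp add: P_def)
  \<comment> \<open>Subadditivity is what is needed, since a prime up to \<open>Y\<close> may also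
    be bad.\<close>
  have Un: "(\<Sum>p\<in>U \<union> V. ln (real p) / real p) \<le> (\<Sum>p\<in>U. ln (real p) / real p) + (\<Sum>p\<in>V. ln (real p) / real p)"
    if "finite U" "finite V" for U V :: "nat set"
    using sum.union_inter[OF that, of "\<lambda>p. ln (real p) / real p"]
      sum_nonneg[of "U \<inter> V" "\<lambda>p. ln (real p) / real p"] by (smt (verit) ln_of_nat_div_nonneg)
  have "(\<Sum>p\<in>odd_primes Q. ln (real p) / real p) \<le> (\<Sum>p\<in>P \<union> (odd_primes Y \<union> bad). ln (real p) / real p)"
    using finbad finP by (intro sum_mono2 ln_of_nat_div_nonneg) (auto simp: P_def)
  then have split: "(\<Sum>p\<in>odd_primes Q. ln (real p) / real p) \<le> (\<Sum>p\<in>P. ln (real p) / real p) +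
      ((\<Sum>p\<in>odd_primes Y. ln (real p) / real p) + (\<Sum>p\<in>bad. ln (real p) / real p))"
    using Un[of P "odd_primes Y \<union> bad"] Un[of "odd_primes Y" bad] finP finbad by simp
  have "ln (real Y) \<le> 499 / 1000 * ?L"
  proof -
    have "ln (real Y) \<le> ln y" using Y by (intro ln_mono) auto
    also have "\<dots> = 499 / 1000 * ?L" using X1 by (simp add: y_def ln_powr)
    finally show ?thesis .
  qed
  moreover have "\<kappa> * ?L \<le> 1 / 100000 * ?L" using \<kappa> L by (intro mult_right_mono) auto
  moreover have "(1 / 2 - \<kappa>) * ?L = 1 / 2 * ?L - \<kappa> * ?L" by (rule left_diff_distrib)
  ultimately have "1 \<le> (\<Sum>p\<in>P. ln (real p) / real p)"
    using split bad_weight Q(3) odd_primes_mertens_lower[OF Q(1)] odd_primes_mertens_upper[OF Y(1)] L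
    by linarith
  moreover have yp: "y < real p" if "p \<in> P" for p
  proof -
    have "\<not> p \<le> Y" using that by (auto simp: P_def odd_primes_def)
    then have "real p \<ge> real Y + 1" by linarith
    then show ?thesis using Y by linarith
  qed
  moreover have "(\<Sum>p\<in>P. ln (real p) / real p) \<le> (\<Sum>p\<in>P. ?L / y)"
  proof (intro sum_mono frac_le)
    fix p assume p: "p \<in> P"
    then have "real p \<le> real R" using Q(2) by (auto simp: P_def odd_primes_def)
    also have "\<dots> \<le> real X" using real_R_le real_sqrt_le_iff[of "real X" "(real X)\<^sup>2"] X1
      by (simp add: power2_eq_square)
    finally show "ln (real p) \<le> ?L" using yp[OF p] y1 by (intro ln_mono) auto
    show "y \<le> real p" using yp[OF p] by simp
  qed (use L y1 in auto)
  ultimately have "1 \<le> real (card P) * (?L / y)" by simp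
  then have "y \<le> real (card P) * ?L" using y1 by (simp add: field_simps)
  moreover have "P \<subseteq> odd_primes R" using Q(2) by (auto simp: P_def odd_primes_def)
  moreover have "real p * variance B p \<le> \<delta> / 2 * ?n\<^sup>2" if "p \<in> P" for p
    using that by (auto simp: P_def bad_def)
  ultimately show ?thesis using that[of P] yp by (simp add: y_def)
qed

text \<open>\<open>many_popular_differences\<close> is applied with \<eta> = \<delta>/2 and \<tau> =
  X^(498/1000). Since \<delta>^2 L >= 1, every inverse power of \<delta> costs only logarithms, and
  the growth conditions in \<open>large\<close> are the powers of X left over to pay for
  them.\<close>

lemma card_le_of_energy:
  assumes \<delta>: "0 < \<delta>" "\<delta> \<le> 1" "1 \<le> \<delta>\<^sup>2 / 100000 * ln (real X)"
    and energy: "\<And>p. p \<in> odd_primes R \<Longrightarrow>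
      (1 / 16 + \<delta>) * real p ^ 3 \<le> real (card (additive_quadruples p (S p)))"
    and L: "20000 \<le> ln (real X)"
    and large: "2 * ln (real X) \<le> real X powr (499 / 1000)"
      "16 * (ln (real X))\<^sup>2 * (4 + ln (real X)) \<le> real X powr (98 / 100000)"
      "4 * ln (real X) \<le> real X powr (199 / 100000)"
  shows "real (card B) \<le> real X powr (1 / 2 - \<delta>\<^sup>2 / 100000)"
proof (rule ccontr)
  let ?L = "ln (real X)" and ?n = "real (card B)"
  assume "\<not> ?thesis"
  then have n: "real X powr (1 / 2 - \<delta>\<^sup>2 / 100000) < ?n" by simp
  obtain P where P: "P \<subseteq> odd_primes R" "real X powr (499 / 1000) \<le> real (card P) * ?L"
    "\<And>p. p \<in> P \<Longrightarrow> real X powr (499 / 1000) < real p"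
    "\<And>p. p \<in> P \<Longrightarrow> real p * variance B p \<le> \<delta> / 2 * ?n\<^sup>2"
    using many_good_primes[OF n \<delta> L] by blast
  have X1: "real X \<ge> 1" using X by simp
  have \<delta>2: "\<delta>\<^sup>2 \<le> \<delta>" using \<delta> by (simp add: power2_eq_square mult_left_le)
  have \<delta>L: "1 \<le> \<delta>\<^sup>2 * ?L" "1 \<le> \<delta> * ?L"
  proof -
    have "\<delta>\<^sup>2 / 100000 * ?L \<le> \<delta>\<^sup>2 * ?L" using L \<delta> by (intro mult_right_mono) auto
    then show "1 \<le> \<delta>\<^sup>2 * ?L" using \<delta>(3) by linarith
    also have "\<dots> \<le> \<delta> * ?L" using L \<delta>2 by (intro mult_right_mono) auto
    finally show "1 \<le> \<delta> * ?L" .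
  qed
  have n': "real X powr (49999 / 100000) \<le> ?n"
  proof -
    have "real X powr (49999 / 100000) \<le> real X powr (1 / 2 - \<delta>\<^sup>2 / 100000)"
      using X1 \<delta> \<delta>2 by (intro powr_mono) auto
    then show ?thesis using n by linarith
  qed
  have finP: "finite P" using finite_subset[OF P(1) finite_odd_primes] .
  have P0: "P \<noteq> {}"
  proof
    assume "P = {}"
    then have "real X powr (499 / 1000) \<le> 0" using P(2) by simp
    then show False using X1 by simp
  qed
  have B0: "B \<noteq> {}"
  proof
    assume "B = {}"
    then have "real X powr (49999 / 100000) \<le> 0" using n' by simp
    then show False using X1 by simp
  qed
  have "\<exists>r. 0 < r \<and> r < p \<and> \<delta> / 2 * ?n\<^sup>2 \<le> (cmod (expsum B (real r / real p)))\<^sup>2" if p: "p \<in> P" for p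
  proof -
    have pR: "p \<in> odd_primes R" using p P(1) by blast
    then have p3: "p > 0" using odd_primesD by fastforce
    \<comment> \<open>The lower bound on good primes is needed here: 2/\<delta> <= 2L <=
      X^(499/1000) < p.\<close>
    have "2 / \<delta> \<le> 2 * ?L" using \<delta>L(2) \<delta>(1) by (simp add: field_simps)
    then have "2 / \<delta> \<le> real p" using large(1) P(3)[OF p] by linarith
    then obtain r where r: "0 < r" "r < p" "2 * \<delta> * (real p)\<^sup>2 \<le> (cmod (expsum (S p) (real r / real p)))\<^sup>2"
      using large_fourier_coefficient[OF \<delta>(1) _ p3 S[OF pR] card_S[OF pR] energy[OF pR]] by blast
    then show ?thesis
      using fourier_coefficient_transfer[OF finite_B residues[OF pR] p3 S[OF pR] S_nonempty[OF pR] \<delta>(1) r(3)]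
        P(4)[OF p] unfolding variance_def by blast
  qed
  then obtain r where r: "\<And>p. p \<in> P \<Longrightarrow> 0 < r p \<and> r p < p \<and>
      \<delta> / 2 * ?n\<^sup>2 \<le> (cmod (expsum B (real (r p) / real p)))\<^sup>2" by metis
  have pq: "p * q \<le> X" if "p \<in> P" "q \<in> P" for p q
  proof -
    have "p \<le> R" "q \<le> R" using that P(1) by (auto simp: odd_primes_def)
    then have "p * q \<le> R * R" by (intro mult_mono) auto
    moreover have "real R * real R \<le> sqrt (real X) * sqrt (real X)" using real_R_le by (intro mult_mono) auto
    then have "real (R * R) \<le> real X" using X1 by simp
    then have "R * R \<le> X" by (simp only: of_nat_le_iff)
    ultimately show ?thesis by linarith
  qed
  define \<tau> where "\<tau> = real X powr (1 / 2 - 1 / 500)"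
  define D where "D = {d\<in>{- int X..int X}. \<tau> < real (difference_count B d)}"
  have "\<delta> / 2 / 2 * ?n \<le> real (card D)"
    unfolding D_def
  proof (rule many_popular_differences[where r = r, OF B B0 X finP P0])
    show "\<tau> * (real X * (4 + ?L)) \<le> (\<delta> / 2)\<^sup>2 / 4 * real (card P) * ?n\<^sup>2"
    proof -
      define x where "x = real X"
      have x: "x \<ge> 1" using X1 by (simp add: x_def)
      have "\<tau> * (x * (4 + ?L)) * (16 * ?L\<^sup>2) = x powr (1 / 2 - 1 / 500) * x powr 1 * (16 * ?L\<^sup>2 * (4 + ?L))"
        using x by (simp add: \<tau>_def x_def)
      also have "\<dots> \<le> x powr (1 / 2 - 1 / 500) * x powr 1 * x powr (98 / 100000)"
        using large(2) by (intro mult_left_mono) (auto simp: x_def)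
      \<comment> \<open>Exponents: 498/1000 + 1 + 98/100000 = 499/1000 + 2 * 49999/100000, the right
        side coming from |P| and from n^2.\<close>
      also have "\<dots> = x powr (499 / 1000) * (x powr (49999 / 100000) * x powr (49999 / 100000))"
        unfolding powr_add[symmetric] by simp
      also have "\<dots> \<le> (real (card P) * ?L) * (?n * ?n)"
        using P(2) n' L by (intro mult_mono) (auto simp: x_def)
      also have "\<dots> \<le> (\<delta>\<^sup>2 * ?L) * ((real (card P) * ?L) * (?n * ?n))"
        using \<delta>L(1) L mult_right_mono[of 1 "\<delta>\<^sup>2 * ?L" "(real (card P) * ?L) * (?n * ?n)"] by simp
      also have "\<dots> = ((\<delta> / 2)\<^sup>2 / 4 * real (card P) * ?n\<^sup>2) * (16 * ?L\<^sup>2)"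
        by (simp add: power2_eq_square)
      finally show ?thesis unfolding x_def
        by (rule mult_right_le_imp_le) (use L in auto)
    qed
  qed (use r pq P(1) \<delta> in \<open>auto simp: \<tau>_def dest: odd_primesD\<close>)
  moreover have "\<tau> \<le> \<delta> / 2 / 2 * ?n"
  proof -
    have "\<tau> * (4 * ?L) \<le> \<tau> * real X powr (199 / 100000)" using large(3) by (intro mult_left_mono) (auto simp: \<tau>_def)
    also have "\<dots> = real X powr (49999 / 100000)" by (simp add: \<tau>_def flip: powr_add)
    also have "\<dots> \<le> (\<delta> * ?L) * ?n" using n' \<delta>L(2) mult_right_mono[of 1 "\<delta> * ?L" ?n] by simp
    finally have "\<tau> * (4 * ?L) \<le> (\<delta> / 2 / 2 * ?n) * (4 * ?L)" by (simp add: mult_ac)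
    then show ?thesis using L by (subst (asm) mult_le_cancel_right) auto
  qed
  moreover have "real (card D) < \<tau>"
    unfolding \<tau>_def using L by (intro few_popular_differences) (auto simp: D_def \<tau>_def)
  ultimately show False by linarith
qed

end

section \<open>Passage from the locale to the theorem\<close>

lemma sieving_primes_eq: "sieving_primes X = odd_primes (nat \<lfloor>sqrt (real X)\<rfloor>)"
proof -
  have "real p \<le> sqrt (real X) \<longleftrightarrow> p \<le> nat \<lfloor>sqrt (real X)\<rfloor>" for p
    by (simp add: le_nat_floor le_floor_iff nat_le_iff le_nat_iff)
  then show ?thesis by (auto simp: sieving_primes_def odd_primes_def powr_half_sqrt)
qed

text \<open>Applied at p = 3, where S has 2 elements and at most 2^4 quadruples exist. It gives
  \<delta> <= 1, hence \<delta>^2 <= \<delta>; the threshold X >= 9 in the theorem makes 3 a sieving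
  prime.\<close>

lemma energy_excess_le_1:
  assumes "card S = 2" "(1 / 16 + \<delta>) * 3 ^ 3 \<le> real (card (additive_quadruples p S))"
  shows "\<delta> \<le> (1 :: real)"
proof -
  have fin: "finite S" using assms(1) by (metis card.infinite zero_neq_numeral)
  have "additive_quadruples p S \<subseteq> S \<times> S \<times> S \<times> S" by (auto simp: additive_quadruples_def)
  then have "card (additive_quadruples p S) \<le> card (S \<times> S \<times> S \<times> S)"
    using fin by (intro card_mono) auto
  also have "\<dots> = 16" using assms(1) by (simp add: card_cartesian_product)
  finally have "real (card (additive_quadruples p S)) \<le> 16" by simp
  then show ?thesis using assms(2) by simp
qed

theorem theorem1p1:
  "\<exists>c > 0 :: real. \<exists>C > 0 :: real. \<exists>X0 :: nat.
     \<forall>X \<ge> X0. \<forall>\<delta> > 0 :: real. \<forall>(S :: nat \<Rightarrow> int set) (A :: nat set).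
       (\<forall>p \<in> sieving_primes X.
          S p \<subseteq> carrier (residue_ring (int p)) \<and>
          real (card (S p)) = (real p + 1) / 2 \<and>
          real (card (additive_quadruples p (S p))) \<ge> (1 / 16 + \<delta>) * real p ^ 3) \<longrightarrow>
       (\<forall>a \<in> A. a > 0) \<longrightarrow>
       (\<forall>p \<in> sieving_primes X. residue_classes_mod A p \<subseteq> S p) \<longrightarrow>
       real (card (truncation A X)) \<le> C * real X powr (1 / 2 - c * \<delta> ^ 2)"
proof -
  have "eventually (\<lambda>X::nat. 20000 \<le> ln (real X)) sequentially"
    "eventually (\<lambda>X::nat. 2 * ln (real X) \<le> real X powr (499 / 1000)) sequentially"
    "eventually (\<lambda>X::nat. 16 * (ln (real X))\<^sup>2 * (4 + ln (real X)) \<le> real X powr (98 / 100000)) sequentially"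
    "eventually (\<lambda>X::nat. 4 * ln (real X) \<le> real X powr (199 / 100000)) sequentially"
    "eventually (\<lambda>X::nat. exp 15 \<le> real X) sequentially"
    by real_asymp+
  then have "eventually (\<lambda>X::nat. 20000 \<le> ln (real X) \<and> 2 * ln (real X) \<le> real X powr (499 / 1000) \<and>
      16 * (ln (real X))\<^sup>2 * (4 + ln (real X)) \<le> real X powr (98 / 100000) \<and>
      4 * ln (real X) \<le> real X powr (199 / 100000) \<and> exp 15 \<le> real X) sequentially"
    by (intro eventually_conj)
  then obtain X0 where X0: "\<And>X. X \<ge> X0 \<Longrightarrow> 20000 \<le> ln (real X) \<and> 2 * ln (real X) \<le> real X powr (499 / 1000) \<and>
      16 * (ln (real X))\<^sup>2 * (4 + ln (real X)) \<le> real X powr (98 / 100000) \<and>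
      4 * ln (real X) \<le> real X powr (199 / 100000) \<and> exp 15 \<le> real X"
    unfolding eventually_sequentially by blast
  \<comment> \<open>The constant of \<open>card_le_sqrt\<close>, times e for the range of small
    \<delta>.\<close>
  define C where "C = 2 * (exp 15 + 1) * exp (1 :: real)"
  have C1: "C \<ge> 1"
  proof -
    have "1 * 1 \<le> 2 * (exp 15 + 1) * exp (1 :: real)"
      by (intro mult_mono) (auto simp: add_nonneg_nonneg add_increasing)
    then show ?thesis by (simp add: C_def)
  qed
  have main: "real (card (truncation A X)) \<le> C * real X powr (1 / 2 - 1 / 100000 * \<delta> ^ 2)"
    if X_large: "X \<ge> max X0 9" and \<delta>: "\<delta> > 0"
      and S: "\<forall>p \<in> sieving_primes X.
          S p \<subseteq> carrier (residue_ring (int p)) \<and>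
          real (card (S p)) = (real p + 1) / 2 \<and>
          real (card (additive_quadruples p (S p))) \<ge> (1 / 16 + \<delta>) * real p ^ 3"
      and A: "\<forall>a \<in> A. a > 0" "\<forall>p \<in> sieving_primes X. residue_classes_mod A p \<subseteq> S p"
    for X \<delta> and S :: "nat \<Rightarrow> int set" and A :: "nat set"
  proof -
    define R where "R = nat \<lfloor>sqrt (real X)\<rfloor>"
    define B where "B = int ` truncation A X"
    have sp: "sieving_primes X = odd_primes R" unfolding R_def by (rule sieving_primes_eq)
    have SR: "S p \<subseteq> {0..<int p} \<and> 2 * card (S p) = p + 1 \<and>
        (1 / 16 + \<delta>) * real p ^ 3 \<le> real (card (additive_quadruples p (S p)))"
      if p: "p \<in> odd_primes R" for p
    proof -
      have "carrier (residue_ring (int p)) = {0..<int p}" by (auto simp: residue_ring_def)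
      moreover have "2 * card (S p) = p + 1"
      proof -
        have "real (card (S p)) = (real p + 1) / 2" using S p sp by blast
        then have "real (2 * card (S p)) = real (p + 1)" by simp
        then show ?thesis by (simp only: of_nat_eq_iff)
      qed
      ultimately show ?thesis using S p sp by auto
    qed
    interpret half_sieved X R S B
    proof
      show "B \<subseteq> {1..int X}" by (auto simp: B_def truncation_def)
      show "X \<ge> 1" using X_large by simp
      show "R = nat \<lfloor>sqrt (real X)\<rfloor>" by (rule R_def)
      show "b mod int p \<in> S p" if "p \<in> odd_primes R" "b \<in> B" for p b
        using that A(2) sp by (auto simp: B_def truncation_def residue_classes_mod_def)
    qed (use SR in auto)
    have cB: "card (truncation A X) = card B" by (simp add: B_def card_image)
    have X9: "real X \<ge> 9" using X_large by simp
    have three: "3 \<in> odd_primes R"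
    proof -
      have "sqrt 9 \<le> sqrt (real X)" using X9 by (simp only: real_sqrt_le_iff)
      then have "3 \<le> sqrt (real X)" by simp
      then have "3 \<le> R" unfolding R_def by (simp add: le_nat_iff le_floor_iff)
      moreover have "prime (3 :: nat)" by simp
      ultimately show ?thesis by (simp add: odd_primes_def)
    qed
    have \<delta>1: "\<delta> \<le> 1"
      using SR[OF three] by (intro energy_excess_le_1[of "S 3" \<delta> 3]) auto
    have big: "20000 \<le> ln (real X) \<and> 2 * ln (real X) \<le> real X powr (499 / 1000) \<and>
      16 * (ln (real X))\<^sup>2 * (4 + ln (real X)) \<le> real X powr (98 / 100000) \<and>
      4 * ln (real X) \<le> real X powr (199 / 100000) \<and> exp 15 \<le> real X"
      using X_large by (intro X0) simp
    show ?thesis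
    proof (cases "1 \<le> \<delta>\<^sup>2 / 100000 * ln (real X)")
      case True
      have "real (card B) \<le> 1 * real X powr (1 / 2 - \<delta>\<^sup>2 / 100000)"
        using card_le_of_energy[OF \<delta> \<delta>1 True _ ] SR big by simp
      also have "\<dots> \<le> C * real X powr (1 / 2 - \<delta>\<^sup>2 / 100000)" using C1 by (intro mult_right_mono) auto
      finally show ?thesis unfolding cB by simp
    next
      \<comment> \<open>Here the saving X^(\<delta>^2/100000) is less than e, so the O(sqrt X) bound
        already suffices.\<close>
      case False
      have "sqrt (real X) = real X powr (1 / 2 - \<delta>\<^sup>2 / 100000) * exp (\<delta>\<^sup>2 / 100000 * ln (real X))"
        using X9 by (simp add: powr_def powr_half_sqrt[symmetric] flip: exp_add) (simp add: algebra_simps)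
      also have "\<dots> \<le> real X powr (1 / 2 - \<delta>\<^sup>2 / 100000) * exp 1"
        using False by (intro mult_left_mono) auto
      finally have "2 * (exp 15 + 1) * sqrt (real X) \<le>
          2 * (exp 15 + 1) * (real X powr (1 / 2 - \<delta>\<^sup>2 / 100000) * exp 1)"
        by (intro mult_left_mono) (auto simp: add_nonneg_nonneg)
      moreover have "real (card B) \<le> 2 * (exp 15 + 1) * sqrt (real X)" using big by (intro card_le_sqrt) simp
      ultimately show ?thesis unfolding cB C_def by (simp add: mult_ac)
    qed
  qed
  show ?thesis
    by (rule exI[of _ "1 / 100000"], rule conjI, simp, rule exI[of _ C], rule conjI,
        use C1 in simp, rule exI[of _ "max X0 9"], intro allI impI, rule main; assumption)
qed

end
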